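(* Let $N,k$ be integers with $1\le k<N$. The set of tangential points of $\mathcal H_{N,k}$ is thin in $\mathcal H_{N,k}$, i.e. it is contained in the union of finitely many manifolds of real dimension lower than $4k$.
   Context: $\mathbb M_{N,N}$ is the space of complex $N\times N$ matrices, regarded as a real Euclidean space of dimension $2N^2$. $\mathcal H_N$ is the linear subspace of Hankel matrices ($A(j,l)=A(j',l')$ whenever $j+l=j'+l'$), $\mathcal R_{N,k}$ is the set of matrices in $\mathbb M_{N,N}$ of rank at most $k$, and $\mathcal H_{N,k}=\mathcal R_{N,k}\cap\mathcal H_N$. The set $\mathcal H_{N,k}$ is, outside a set contained in finitely many manifolds of lower dimension, a real differentiable manifold of dimension $4k$; "thin in $\mathcal H_{N,k}$" means contained in a finite union of manifolds of dimension less than $4k$. A point $A\in\mathcal H_{N,k}$ is called regular if in a neighborhood of $A$ each of the sets $\mathcal R_{N,k}$, $\mathcal H_{N,k}$ and $\mathcal H_N$ is a manifold of constant dimension. A (regular) point $A\in\mathcal H_{N,k}$ is called non-tangential if $$T_{\mathcal R_{N,k}}(A)\cap T_{\mathcal H_N}(A)=T_{\mathcal R_{N,k}\cap\mathcal H_N}(A),$$ where $T_{\mathcal M}(A)$ denotes the tangent space of $\mathcal M$ at $A$ (as a linear subspace of $\mathbb M_{N,N}$), and tangential if this equality fails. *)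

theory Defs
  imports "HOL-Analysis.Analysis"
begin

section \<open>Embedded differentiable manifolds in a Euclidean space\<close>

definition C1_on :: "('a::real_normed_vector \<Rightarrow> 'b::real_normed_vector) \<Rightarrow> 'a set \<Rightarrow> bool" where
  "C1_on f U \<longleftrightarrow> (\<exists>f' :: 'a \<Rightarrow> 'a \<Rightarrow>\<^sub>L 'b.
     (\<forall>x\<in>U. (f has_derivative blinfun_apply (f' x)) (at x)) \<and> continuous_on U f')"

definition C1_diffeomorphism ::
  "'a::euclidean_space set \<Rightarrow> 'a set \<Rightarrow> ('a \<Rightarrow> 'a) \<Rightarrow> ('a \<Rightarrow> 'a) \<Rightarrow> bool" where
  "C1_diffeomorphism U V f g \<longleftrightarrow> open U \<and> open V \<and> homeomorphism U V f g \<and> C1_on f U \<and> C1_on g V"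

text \<open>
  A differentiable manifold is an embedded (not necessarily closed) \<open>C\<^sup>1\<close> submanifold: locally it
  can be flattened, by a diffeomorphism of the ambient space, to a \<open>d\<close>-dimensional linear
  subspace. Dimensions are real dimensions. The empty set is a manifold of every dimension.
\<close>
definition manifold :: "nat \<Rightarrow> 'a::euclidean_space set \<Rightarrow> bool" where
  "manifold d M \<longleftrightarrow> (\<forall>A\<in>M. \<exists>U V f g L. C1_diffeomorphism U V f g \<and> A \<in> U \<and>
     subspace L \<and> dim L = d \<and> f ` (M \<inter> U) = L \<inter> V)"

definition manifold_near :: "'a::euclidean_space set \<Rightarrow> 'a \<Rightarrow> bool" where
  "manifold_near M A \<longleftrightarrow> (\<exists>W d. open W \<and> A \<in> W \<and> manifold d (M \<inter> W))"

text \<open>The velocity vectors at \<open>A\<close> of the \<open>C\<^sup>1\<close> curves in \<open>M\<close> through \<open>A\<close>.\<close>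
definition tangent_space :: "'a::euclidean_space set \<Rightarrow> 'a \<Rightarrow> 'a set" where
  "tangent_space M A = {v. \<exists>\<gamma> :: real \<Rightarrow> 'a. \<exists>e>0. C1_on \<gamma> {-e<..<e} \<and> \<gamma> ` {-e<..<e} \<subseteq> M \<and>
     \<gamma> 0 = A \<and> (\<gamma> has_vector_derivative v) (at 0)}"

definition thin :: "nat \<Rightarrow> 'a::euclidean_space set \<Rightarrow> bool" where
  "thin d S \<longleftrightarrow> (\<exists>\<M>. finite \<M> \<and> (\<forall>M\<in>\<M>. \<exists>m<d. manifold m M) \<and> S \<subseteq> \<Union>\<M>)"

section \<open>Hankel matrices of bounded rank\<close>

text \<open>
  The indices of an \<open>N \<times> N\<close> matrix are the elements of a linearly ordered finite type with \<open>N\<close>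
  elements; \<open>index_pos\<close> numbers them increasingly by \<open>0, \<dots>, N - 1\<close>. The type
  \<open>complex^'n^'n\<close> is a real Euclidean space of dimension \<open>2 * N\<^sup>2\<close>, whereas \<open>rank\<close> is the rank
  over the complex numbers.
\<close>
definition index_pos :: "'n::{finite,linorder} \<Rightarrow> nat" where
  "index_pos j = card {i. i < j}"

definition hankel_matrices :: "(complex^'n::{finite,linorder}^'n::{finite,linorder}) set" where
  "hankel_matrices = {A. \<forall>j l j' l'.
     index_pos j + index_pos l = index_pos j' + index_pos l' \<longrightarrow> A $ j $ l = A $ j' $ l'}"

definition rank_le_matrices :: "nat \<Rightarrow> (complex^'n^'n) set" where
  "rank_le_matrices k = {A. rank A \<le> k}"

definition hankel_rank_le :: "nat \<Rightarrow> (complex^'n::{finite,linorder}^'n::{finite,linorder}) set" where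
  "hankel_rank_le k = rank_le_matrices k \<inter> hankel_matrices"

definition regular_point :: "nat \<Rightarrow> complex^'n::{finite,linorder}^'n::{finite,linorder} \<Rightarrow> bool" where
  "regular_point k A \<longleftrightarrow> A \<in> hankel_rank_le k \<and>
     manifold_near (rank_le_matrices k) A \<and>
     manifold_near (hankel_rank_le k) A \<and>
     manifold_near hankel_matrices A"

definition non_tangential :: "nat \<Rightarrow> complex^'n::{finite,linorder}^'n::{finite,linorder} \<Rightarrow> bool" where
  "non_tangential k A \<longleftrightarrow> regular_point k A \<and>
     tangent_space (rank_le_matrices k) A \<inter> tangent_space hankel_matrices A =
     tangent_space (rank_le_matrices k \<inter> hankel_matrices) A"

text \<open>Tangent spaces are only meaningful at regular points, so tangential points are regular.\<close>
definition tangential :: "nat \<Rightarrow> complex^'n::{finite,linorder}^'n::{finite,linorder} \<Rightarrow> bool" where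
  "tangential k A \<longleftrightarrow> regular_point k A \<and>
     tangent_space (rank_le_matrices k) A \<inter> tangent_space hankel_matrices A \<noteq>
     tangent_space (rank_le_matrices k \<inter> hankel_matrices) A"

end

theory Submission
  imports Defs
begin

text \<open>
  A Hankel matrix is given by its symbol, the sequence \<open>h\<^sub>0, \<dots>, h\<^bsub>2N-2\<^esub>\<close> of its antidiagonal entries, or
  equivalently by the functional \<open>z\<^sup>m \<mapsto> h\<^sub>m\<close> on polynomials of degree at most \<open>2N - 2\<close>. The proof
  covers the Hankel matrices of rank at most \<open>k\<close> by finitely many manifolds, called strata below,
  and shows that all tangential points avoid the only one that has full dimension.
  
  The strata. If the leading \<open>r \<times> r\<close> block is regular, then the first \<open>2r\<close> terms of the symbol
  determine a linear recurrence of order \<open>r\<close>, and with it a continuation to an infinite sequence.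
  The stratum with parameters \<open>(r, s)\<close> consists of the matrices whose symbol follows this
  continuation up to its last \<open>s\<close> terms, which are arbitrary. By Cramer's rule the continuation is a
  rational function of the first \<open>2r\<close> terms, so a stratum is the graph of a \<open>C\<^sup>1\<close> function over an
  open subset of a linear space of real dimension at most \<open>2(2r + s)\<close>, hence a manifold
  (\<open>manifold_stratum\<close>). Every Hankel matrix of rank at most \<open>k < N\<close> lies in a stratum with
  \<open>r + s \<le> k\<close> (\<open>hankel_rank_le_covered\<close>). Now \<open>2(2r + s) < 4k\<close> unless \<open>(r, s) = (k, 0)\<close>, so it
  remains to see that the points of this generic stratum are non-tangential.
  
  The generic stratum (\<open>generic_stratum_tangent_space\<close>). Let \<open>q\<close> be the monic polynomial of degree
  \<open>k\<close> that belongs to the recurrence of a point \<open>A\<close>. The kernel of \<open>A\<close> consists of the coefficient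
  vectors of the multiples of \<open>q\<close>, and a tangent vector \<open>B\<close> of the matrices of rank at most \<open>k\<close>
  satisfies \<open>w\<^sup>T B u = 0\<close> for \<open>u, w\<close> in this kernel. For Hankel \<open>B\<close> this says that its functional
  vanishes on the multiples of \<open>q\<^sup>2\<close>. Because \<open>q\<^sup>2\<close> is monic of degree \<open>2k\<close>, such a \<open>B\<close> is determined
  by its first \<open>2k\<close> terms. But these can be prescribed freely for the velocity of a curve in the
  generic stratum; so every common tangent vector is the velocity of a curve in the intersection.
\<close>

section \<open>Continuously differentiable maps and graphs\<close>

text \<open>
  In finite dimensions it is enough that every directional derivative is continuous. This avoids
  operator-valued derivatives in the product and quotient rules below.
\<close>
lemma C1_on_iff_directional:
  fixes f :: "'a::euclidean_space \<Rightarrow> 'b::real_normed_vector"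
  shows "C1_on f U \<longleftrightarrow> (\<exists>f'. (\<forall>x\<in>U. (f has_derivative f' x) (at x)) \<and>
    (\<forall>v. continuous_on U (\<lambda>x. f' x v)))" (is "_ \<longleftrightarrow> ?R")
proof
  assume "C1_on f U"
  then obtain f' :: "'a \<Rightarrow> 'a \<Rightarrow>\<^sub>L 'b"
    where "\<forall>x\<in>U. (f has_derivative blinfun_apply (f' x)) (at x)" "continuous_on U f'"
    unfolding C1_on_def by blast
  then show ?R
    by (intro exI[of _ "\<lambda>x. blinfun_apply (f' x)"]) (auto intro!: continuous_intros)
next
  assume ?R
  then obtain f' where f': "\<And>x. x \<in> U \<Longrightarrow> (f has_derivative f' x) (at x)"
    "\<And>v. continuous_on U (\<lambda>x. f' x v)"
    by blast
  have apply_eq: "blinfun_apply (Blinfun (f' x)) = f' x" if "x \<in> U" for x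
    using f'(1)[OF that] by (intro bounded_linear_Blinfun_apply has_derivative_bounded_linear)
  have "continuous_on U (\<lambda>x. Blinfun (f' x))"
  proof (rule continuous_on_blinfun_componentwise)
    fix i :: 'a
    show "continuous_on U (\<lambda>x. blinfun_apply (Blinfun (f' x)) i)"
      using f'(2)[of i] by (rule continuous_on_eq) (simp add: apply_eq)
  qed
  with f'(1) apply_eq show "C1_on f U"
    unfolding C1_on_def by (intro exI[of _ "\<lambda>x. Blinfun (f' x)"]) auto
qed

lemma C1_on_imp_continuous_on: "C1_on f U \<Longrightarrow> continuous_on U f"
  unfolding C1_on_def
  by (meson continuous_at_imp_continuous_on has_derivative_continuous)

lemma C1_on_cong:
  assumes "C1_on f U" "open U" "\<And>x. x \<in> U \<Longrightarrow> f x = g x"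
  shows "C1_on g U"
  using assms unfolding C1_on_def
  by (metis (no_types, lifting) has_derivative_transform_within_open)

lemma C1_on_bounded_linear: "bounded_linear f \<Longrightarrow> C1_on f U"
  unfolding C1_on_def
  by (intro exI[of _ "\<lambda>_. Blinfun f"])
    (auto simp: bounded_linear_Blinfun_apply intro: bounded_linear_imp_has_derivative)

lemma C1_on_const: "C1_on (\<lambda>_. c) U"
  unfolding C1_on_def by (intro exI[of _ "\<lambda>_. 0"]) (auto simp: zero_blinfun.rep_eq)

lemma C1_on_add:
  assumes "C1_on f U" "C1_on g U"
  shows "C1_on (\<lambda>x. f x + g x) U"
proof -
  obtain f' g' where "\<forall>x\<in>U. (f has_derivative blinfun_apply (f' x)) (at x)" "continuous_on U f'"
    "\<forall>x\<in>U. (g has_derivative blinfun_apply (g' x)) (at x)" "continuous_on U g'"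
    using assms unfolding C1_on_def by blast
  then show ?thesis
    unfolding C1_on_def
    by (intro exI[of _ "\<lambda>x. f' x + g' x"])
      (auto simp: plus_blinfun.rep_eq intro!: has_derivative_add continuous_intros)
qed

lemma C1_on_compose:
  assumes "C1_on f V" "C1_on g U" "g ` U \<subseteq> V"
  shows "C1_on (\<lambda>x. f (g x)) U"
proof -
  obtain f' g' where f': "\<forall>x\<in>V. (f has_derivative blinfun_apply (f' x)) (at x)" "continuous_on V f'"
    and g': "\<forall>x\<in>U. (g has_derivative blinfun_apply (g' x)) (at x)" "continuous_on U g'"
    using assms unfolding C1_on_def by blast
  have "continuous_on U (\<lambda>x. f' (g x))"
    using continuous_on_compose2[OF f'(2) C1_on_imp_continuous_on[OF assms(2)] assms(3)] .
  with f' g' assms(3) show ?thesis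
    unfolding C1_on_def
    by (intro exI[of _ "\<lambda>x. f' (g x) o\<^sub>L g' x"])
      (auto simp: o_def image_subset_iff blinfun_compose.rep_eq
        intro!: continuous_intros has_derivative_compose[where f = g and g = f])
qed

lemma C1_on_diff: 
  assumes "C1_on f U" "C1_on g U"
  shows "C1_on (\<lambda>x. f x - g x) U"
  using C1_on_add[OF assms(1) C1_on_compose[OF C1_on_bounded_linear[of uminus UNIV] assms(2)]]
  by (simp add: bounded_linear_minus)

lemma C1_on_sum:
  assumes "\<And>i. i \<in> I \<Longrightarrow> C1_on (f i) U"
  shows "C1_on (\<lambda>x. \<Sum>i\<in>I. f i x) U"
  using assms by (induction I rule: infinite_finite_induct) (auto intro: C1_on_add C1_on_const)

lemma C1_on_mult:
  fixes f g :: "'a::euclidean_space \<Rightarrow> complex"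
  assumes "C1_on f U" "C1_on g U"
  shows "C1_on (\<lambda>x. f x * g x) U"
proof -
  obtain f' g' where *: "\<forall>x\<in>U. (f has_derivative f' x) (at x)" "\<forall>v. continuous_on U (\<lambda>x. f' x v)"
    "\<forall>x\<in>U. (g has_derivative g' x) (at x)" "\<forall>v. continuous_on U (\<lambda>x. g' x v)"
    using assms unfolding C1_on_iff_directional by blast
  have "continuous_on U f" "continuous_on U g"
    using assms by (auto intro: C1_on_imp_continuous_on)
  with * show ?thesis
    unfolding C1_on_iff_directional
    by (intro exI[of _ "\<lambda>x v. f x * g' x v + f' x v * g x"])
      (auto intro!: has_derivative_mult continuous_intros)
qed

lemma C1_on_divide:
  fixes f g :: "'a::euclidean_space \<Rightarrow> complex"
  assumes "C1_on f U" "C1_on g U" "\<And>x. x \<in> U \<Longrightarrow> g x \<noteq> 0"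
  shows "C1_on (\<lambda>x. f x / g x) U"
proof -
  obtain f' g' where *: "\<forall>x\<in>U. (f has_derivative f' x) (at x)" "\<forall>v. continuous_on U (\<lambda>x. f' x v)"
    "\<forall>x\<in>U. (g has_derivative g' x) (at x)" "\<forall>v. continuous_on U (\<lambda>x. g' x v)"
    using assms unfolding C1_on_iff_directional by blast
  have "continuous_on U f" "continuous_on U g"
    using assms by (auto intro: C1_on_imp_continuous_on)
  with * assms(3) show ?thesis
    unfolding C1_on_iff_directional
    by (intro exI[of _ "\<lambda>x v. (f' x v * g x - f x * g' x v) / (g x * g x)"])
      (auto intro!: has_derivative_divide' continuous_intros)
qed

lemma C1_on_prod:
  fixes f :: "'i \<Rightarrow> 'a::euclidean_space \<Rightarrow> complex"
  assumes "\<And>i. i \<in> I \<Longrightarrow> C1_on (f i) U"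
  shows "C1_on (\<lambda>x. \<Prod>i\<in>I. f i x) U"
  using assms by (induction I rule: infinite_finite_induct) (auto intro: C1_on_mult C1_on_const)

text \<open>
  The determinant is a polynomial in the entries. This, with Cramer's rule, gives the smooth
  dependence of the solution of a linear system on its coefficients.
\<close>
lemma C1_on_det:
  fixes M :: "'a::euclidean_space \<Rightarrow> complex^'n^'n"
  assumes "\<And>i j. C1_on (\<lambda>x. M x $ i $ j) U"
  shows "C1_on (\<lambda>x. det (M x)) U"
  unfolding det_def by (intro C1_on_sum C1_on_mult C1_on_prod C1_on_const assms)

lemma C1_on_matrix:
  fixes M :: "'a::euclidean_space \<Rightarrow> complex^'n^'m"
  assumes "\<And>i j. C1_on (\<lambda>x. M x $ i $ j) U"
  shows "C1_on M U"
proof -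
  have "bounded_linear (\<lambda>c::complex. axis i (axis j c) :: complex^'n^'m)" for i j
    by (simp add: linear_conv_bounded_linear[symmetric] linear_iff axis_def vec_eq_iff)
  then have "C1_on (\<lambda>x. axis i (axis j (M x $ i $ j)) :: complex^'n^'m) U" for i j
    by (rule C1_on_compose[OF C1_on_bounded_linear[of _ UNIV] assms]) simp
  then have "C1_on (\<lambda>x. \<Sum>i\<in>UNIV. \<Sum>j\<in>UNIV. axis i (axis j (M x $ i $ j)) :: complex^'n^'m) U"
    by (intro C1_on_sum)
  also have "(\<lambda>x. \<Sum>i\<in>UNIV. \<Sum>j\<in>UNIV. axis i (axis j (M x $ i $ j))) = M"
  proof (intro ext, subst vec_eq_iff, subst vec_eq_iff, intro allI)
    fix x i j
    have "(\<Sum>a\<in>UNIV. \<Sum>b\<in>UNIV. axis a (axis b (M x $ a $ b)) :: complex^'n^'m) $ i $ j =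
      (\<Sum>a\<in>UNIV. \<Sum>b\<in>UNIV. if i = a then if j = b then M x $ a $ b else 0 else 0)"
      by (simp add: axis_def if_distrib[of "\<lambda>v. v $ _"] cong: if_cong)
    also have "\<dots> = (\<Sum>a\<in>UNIV. if i = a then M x $ a $ j else 0)"
      by (intro sum.cong refl) simp
    finally show "(\<Sum>a\<in>UNIV. \<Sum>b\<in>UNIV. axis a (axis b (M x $ a $ b)) :: complex^'n^'m) $ i $ j =
      M x $ i $ j"
      by simp
  qed
  finally show ?thesis .
qed

text \<open>
  Graphs over an open part of the range of a linear projection \<open>P\<close>, of functions with values in its
  kernel, need no local charts: the shear \<open>x \<mapsto> x - G x\<close> is a diffeomorphism of the open cylinder
  \<open>U\<close> onto itself, with inverse \<open>x \<mapsto> x + G x\<close>, and flattens the whole graph at once.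
\<close>
lemma manifold_graph:
  fixes P G :: "'a::euclidean_space \<Rightarrow> 'a"
  assumes "linear P" and idem: "\<And>x. P (P x) = P x" and "open U" and C1: "C1_on G U"
    and U: "\<And>x. P x \<in> U \<longleftrightarrow> x \<in> U" and GP: "\<And>x. G (P x) = G x" and PG: "\<And>x. P (G x) = 0"
  shows "manifold (dim (range P)) {x\<in>U. x = P x + G x}"
  unfolding manifold_def
proof (intro ballI exI conjI)
  have add: "P (x + y) = P x + P y" "P (x - y) = P x - P y" for x y
    using \<open>linear P\<close> by (simp_all add: linear_add linear_diff)
  have shift: "G (x + G y) = G x" "G (x - G y) = G x" "x + G y \<in> U \<longleftrightarrow> x \<in> U"
    "x - G y \<in> U \<longleftrightarrow> x \<in> U" for x y
    using GP[of "x + G y"] GP[of "x - G y"] GP[of x] U[of "x + G y"] U[of "x - G y"] U[of x]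
    by (simp_all add: add PG)
  show "C1_diffeomorphism U U (\<lambda>x. x - G x) (\<lambda>x. x + G x)"
    unfolding C1_diffeomorphism_def
  proof (intro conjI homeomorphismI)
    show *: "C1_on (\<lambda>x. x - G x) U" "C1_on (\<lambda>x. x + G x) U"
      by (intro C1_on_diff C1_on_add C1_on_bounded_linear[OF bounded_linear_ident] C1)+
    show "continuous_on U (\<lambda>x. x - G x)" "continuous_on U (\<lambda>x. x + G x)"
      using * by (auto intro: C1_on_imp_continuous_on)
  qed (auto simp: \<open>open U\<close> shift)
  show "subspace (range P)" using \<open>linear P\<close> by (simp add: linear_subspace_image)
  show "(\<lambda>x. x - G x) ` ({x\<in>U. x = P x + G x} \<inter> U) = range P \<inter> U" (is "?f ` ?M = _")
  proof (intro equalityI subsetI)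
    fix y assume "y \<in> ?f ` ?M"
    then obtain x where "x \<in> U" "x = P x + G x" "y = x - G x" by blast
    then have "y = P x" by (metis add_diff_cancel_right')
    with \<open>x \<in> U\<close> U show "y \<in> range P \<inter> U" by blast
  next
    fix y assume "y \<in> range P \<inter> U"
    then have "y = P y" "y \<in> U" using idem by auto
    then have "y + G y \<in> ?M" "y = ?f (y + G y)" by (auto simp: shift add PG)
    then show "y \<in> ?f ` ?M" by blast
  qed
qed auto

section \<open>Hankel matrices, their symbols and linear recurrences\<close>

lemma index_pos_less_CARD: "index_pos (j :: 'n::{finite,linorder}) < CARD('n)"
  unfolding index_pos_def by (rule psubset_card_mono) auto

lemma bij_index_pos: "bij_betw (index_pos :: 'n::{finite,linorder} \<Rightarrow> nat) UNIV {..<CARD('n)}"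
proof -
  have "strict_mono (index_pos :: 'n \<Rightarrow> nat)"
    unfolding strict_mono_def index_pos_def by (auto intro!: psubset_card_mono)
  then have inj: "inj (index_pos :: 'n \<Rightarrow> nat)" by (rule strict_mono_imp_inj_on)
  moreover have "range (index_pos :: 'n \<Rightarrow> nat) = {..<CARD('n)}"
    using card_image[OF inj] by (intro card_subset_eq) (auto simp: index_pos_less_CARD)
  ultimately show ?thesis by (simp add: bij_betw_def)
qed

lemma inj_index_pos [simp]: "index_pos (i :: 'n::{finite,linorder}) = index_pos j \<longleftrightarrow> i = j"
  using bij_index_pos[where 'n = 'n] by (auto simp: bij_betw_def inj_eq)

definition index_at :: "nat \<Rightarrow> 'n::{finite,linorder}" where
  "index_at = inv index_pos"

lemma index_at_index_pos [simp]: "index_at (index_pos j) = j"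
  by (simp add: index_at_def inv_f_eq inj_def)

lemma index_pos_index_at [simp]:
  "m < CARD('n) \<Longrightarrow> index_pos (index_at m :: 'n::{finite,linorder}) = m"
  using bij_index_pos[where 'n = 'n] unfolding index_at_def
  by (metis bij_betw_imp_surj_on f_inv_into_f lessThan_iff)

lemma sum_index_pos:
  "(\<Sum>j\<in>UNIV. f (index_pos (j :: 'n::{finite,linorder}))) = (\<Sum>m<CARD('n). f m)"
  using bij_index_pos by (rule sum.reindex_bij_betw)

definition hankel :: "(nat \<Rightarrow> complex) \<Rightarrow> complex^'n::{finite,linorder}^'n::{finite,linorder}" where
  "hankel h = (\<chi> i j. h (index_pos i + index_pos j))"

text \<open>
  The entry of an arbitrary matrix on the \<open>m\<close>-th antidiagonal, read off along the first column and
  then the last row. On Hankel matrices the choice of the entry is immaterial, but a total linear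
  map on all matrices serves as a coordinate of the ambient space. It is meaningful only for
  \<open>m \<le> 2 * N - 2\<close>.
\<close>
definition symbol :: "complex^'n::{finite,linorder}^'n::{finite,linorder} \<Rightarrow> nat \<Rightarrow> complex" where
  "symbol A m = A $ index_at (min m (CARD('n) - 1)) $ index_at (m - min m (CARD('n) - 1))"

lemma hankel_nth [simp]: "hankel h $ i $ j = h (index_pos i + index_pos j)"
  by (simp add: hankel_def)

lemma symbol_hankel:
  assumes "m < 2 * CARD('n) - 1"
  shows "symbol (hankel h :: complex^'n::{finite,linorder}^'n::{finite,linorder}) m = h m"
proof -
  have "min m (CARD('n) - 1) < CARD('n)" "m - min m (CARD('n) - 1) < CARD('n)"
    using assms by auto
  then show ?thesis by (simp add: symbol_def)
qed

lemma index_pos_add_less: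
  "index_pos (i :: 'n::{finite,linorder}) + index_pos (j :: 'n) < 2 * CARD('n) - 1"
  using index_pos_less_CARD[of i] index_pos_less_CARD[of j] by linarith

lemma hankel_cong:
  assumes "\<And>m. m < 2 * CARD('n) - 1 \<Longrightarrow> h m = g m"
  shows "(hankel h :: complex^'n::{finite,linorder}^'n::{finite,linorder}) = hankel g"
  unfolding vec_eq_iff hankel_nth by (intro allI assms index_pos_add_less)

lemma hankel_in_hankel_matrices: "hankel h \<in> hankel_matrices"
  by (simp add: hankel_matrices_def)

lemma hankel_symbol:
  assumes "A \<in> hankel_matrices"
  shows "hankel (symbol A) = (A :: complex^'n::{finite,linorder}^'n::{finite,linorder})"
proof -
  have "symbol A (index_pos i + index_pos j) = A $ i $ j" for i j :: 'n
  proof -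
    define m where "m = index_pos i + index_pos j"
    have "min m (CARD('n) - 1) < CARD('n)" "m - min m (CARD('n) - 1) < CARD('n)"
      using index_pos_add_less[of i j] by (auto simp: m_def)
    then have "index_pos (index_at (min m (CARD('n) - 1)) :: 'n) +
        index_pos (index_at (m - min m (CARD('n) - 1)) :: 'n) = index_pos i + index_pos j"
      by (simp add: m_def)
    with assms show ?thesis
      unfolding hankel_matrices_def symbol_def m_def mem_Collect_eq by blast
  qed
  then show ?thesis by (simp add: vec_eq_iff)
qed

lemma bounded_linear_symbol: "bounded_linear (\<lambda>A. symbol A m)"
  unfolding symbol_def
  by (intro bounded_linear_compose[OF bounded_linear_vec_nth bounded_linear_vec_nth])

text \<open>
  Injectivity of the leading \<open>r \<times> r\<close> block of the Hankel matrix of \<open>h\<close>. The condition concerns a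
  sequence rather than a matrix because \<open>r\<close> varies, which a type-indexed dimension cannot do.
\<close>
definition nondegenerate :: "nat \<Rightarrow> (nat \<Rightarrow> complex) \<Rightarrow> bool" where
  "nondegenerate r h \<longleftrightarrow>
    (\<forall>x. (\<forall>i<r. (\<Sum>j<r. h (i + j) * x j) = 0) \<longrightarrow> (\<forall>j<r. x j = 0))"

text \<open>
  The monic polynomial \<open>z\<^sup>r - (\<Sum>j<r. c\<^sub>j z\<^sup>j)\<close> orthogonal to all lower degrees with respect to the
  moment functional of \<open>h\<close>. Only the values at \<open>j < r\<close> matter; there they are unique if \<open>h\<close> is
  nondegenerate of order \<open>r\<close>.
\<close>
definition recurrence_coeff :: "nat \<Rightarrow> (nat \<Rightarrow> complex) \<Rightarrow> nat \<Rightarrow> complex" where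
  "recurrence_coeff r h = (SOME c. \<forall>i<r. h (i + r) = (\<Sum>j<r. h (i + j) * c j))"

fun continuation :: "nat \<Rightarrow> (nat \<Rightarrow> complex) \<Rightarrow> nat \<Rightarrow> complex" where
  "continuation r h m = (if m < 2 * r then h m
     else \<Sum>j<r. continuation r h (m - r + j) * recurrence_coeff r h j)"

declare continuation.simps [simp del]

text \<open>
  The leading \<open>r \<times> r\<close> block, completed by an identity block to a matrix of full size. It has the
  determinant of the block, and the theory of determinants applies although \<open>r\<close> is not a type.
\<close>
definition leading_block :: "nat \<Rightarrow> (nat \<Rightarrow> complex) \<Rightarrow> complex^'n::{finite,linorder}^'n::{finite,linorder}" where
  "leading_block r h = (\<chi> i j. if index_pos i < r \<and> index_pos j < r
     then h (index_pos i + index_pos j) else if i = j then 1 else 0)"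

lemma leading_block_mult:
  assumes "r \<le> CARD('n)"
  shows "(leading_block r h *v (v :: complex^'n::{finite,linorder})) $ i =
    (if index_pos i < r then \<Sum>j<r. h (index_pos i + j) * v $ index_at j else v $ i)"
proof (cases "index_pos i < r")
  case True
  have "(leading_block r h *v v) $ i = (\<Sum>j\<in>(UNIV :: 'n set). (\<lambda>m. if m < r
    then h (index_pos i + m) * v $ index_at m else 0) (index_pos j))"
    using True by (auto simp: matrix_vector_mult_def leading_block_def intro!: sum.cong)
  also have "\<dots> = (\<Sum>m<CARD('n). if m < r then h (index_pos i + m) * v $ index_at m else 0)"
    by (rule sum_index_pos)
  also have "\<dots> = (\<Sum>j<r. h (index_pos i + j) * v $ index_at j)"
    using assms by (intro sum.mono_neutral_cong_right) auto
  finally show ?thesis using True by simp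
next
  case False
  then have "(leading_block r h *v v) $ i = (\<Sum>j\<in>UNIV. if i = j then v $ j else 0)"
    unfolding matrix_vector_mult_def leading_block_def vec_lambda_beta by (intro sum.cong) auto
  with False show ?thesis by simp
qed

lemma nondegenerate_iff_det:
  assumes "r \<le> CARD('n)"
  shows "nondegenerate r h \<longleftrightarrow> det (leading_block r h :: complex^'n::{finite,linorder}^'n::{finite,linorder}) \<noteq> 0"
proof -
  let ?L = "leading_block r h :: complex^'n::{finite,linorder}^'n::{finite,linorder}"
  have ker: "?L *v v = 0 \<longleftrightarrow> (\<forall>i<r. (\<Sum>j<r. h (i + j) * v $ index_at j) = 0) \<and>
      (\<forall>i. r \<le> index_pos i \<longrightarrow> v $ i = 0)" for v
    using assms by (auto simp: vec_eq_iff leading_block_mult not_less)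
      (metis index_pos_index_at order.strict_trans2)
  have "nondegenerate r h \<longleftrightarrow> (\<forall>v. ?L *v v = 0 \<longrightarrow> v = 0)"
  proof
    assume nd: "nondegenerate r h"
    show "\<forall>v. ?L *v v = 0 \<longrightarrow> v = 0"
    proof (intro allI impI)
      fix v assume v: "?L *v v = 0"
      have at: "v $ index_at j = 0" if "j < r" for j
        using nd v that unfolding ker nondegenerate_def
        by (elim conjE allE[of _ "\<lambda>j. v $ index_at j"]) auto
      have "v $ i = 0" for i
      proof (cases "index_pos i < r")
        case True
        from at[OF this] show ?thesis by simp
      qed (use v in \<open>simp add: ker\<close>)
      then show "v = 0" by (simp add: vec_eq_iff)
    qed
  next
    assume inj: "\<forall>v. ?L *v v = 0 \<longrightarrow> v = 0"
    show "nondegenerate r h"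
      unfolding nondegenerate_def
    proof (intro allI impI)
      fix x j assume x: "\<forall>i<r. (\<Sum>j<r. h (i + j) * x j) = 0" and "j < r"
      define v where "v = (\<chi> i::'n. if index_pos i < r then x (index_pos i) else 0)"
      have v_at: "v $ index_at j = x j" if "j < r" for j
        using that assms by (simp add: v_def)
      have "?L *v v = 0" unfolding ker using x v_at by (simp add: v_def)
      with inj have "v = 0" by blast
      with v_at \<open>j < r\<close> show "x j = 0" by fastforce
    qed
  qed
  then show ?thesis
    by (simp add: invertible_det_nz[symmetric] invertible_left_inverse matrix_left_invertible_ker)
qed

text \<open>
  The second part is the explicit rational formula from which smoothness is derived.
\<close>
lemma recurrence_coeff_cramer:
  fixes L :: "complex^'n::{finite,linorder}^'n::{finite,linorder}"
  assumes "r \<le> CARD('n)" "nondegenerate r h"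
  defines "L \<equiv> leading_block r h"
  shows "\<And>i. i < r \<Longrightarrow> h (i + r) = (\<Sum>j<r. h (i + j) * recurrence_coeff r h j)"
    and "\<And>j. j < r \<Longrightarrow> recurrence_coeff r h j = det (\<chi> i l. if l = index_at j
        then if index_pos i < r then h (index_pos i + r) else 0 else L $ i $ l) / det L"
proof -
  define b where "b = (\<chi> i::'n. if index_pos i < r then h (index_pos i + r) else 0)"
  define x where "x = (\<chi> j. det (\<chi> i l. if l = j then b $ i else L $ i $ l) / det L)"
  have "det L \<noteq> 0" using assms nondegenerate_iff_det by blast
  then have x: "L *v x = b" unfolding x_def by (simp add: cramer)
  define y where "y = (\<lambda>j. x $ index_at j)"
  have y: "\<forall>i<r. h (i + r) = (\<Sum>j<r. h (i + j) * y j)"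
  proof (intro allI impI)
    fix i assume "i < r"
    then have "index_pos (index_at i :: 'n) = i" using assms by simp
    with \<open>i < r\<close> have "(L *v x) $ index_at i = (\<Sum>j<r. h (i + j) * y j)"
      "b $ index_at i = h (i + r)"
      using assms by (simp_all add: L_def leading_block_mult b_def y_def)
    with x show "h (i + r) = (\<Sum>j<r. h (i + j) * y j)" by simp
  qed
  then have "\<exists>c. \<forall>i<r. h (i + r) = (\<Sum>j<r. h (i + j) * c j)" by blast
  from someI_ex[OF this]
  show c: "h (i + r) = (\<Sum>j<r. h (i + j) * recurrence_coeff r h j)" if "i < r" for i
    unfolding recurrence_coeff_def using that by blast
  have "(\<Sum>j<r. h (i + j) * (recurrence_coeff r h j - y j)) = 0" if "i < r" for i
    using c[OF that] y that by (simp add: right_diff_distrib sum_subtractf)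
  then have eq: "recurrence_coeff r h j - y j = 0" if "j < r" for j
    using assms(2) that unfolding nondegenerate_def 
    by (elim allE[of _ "\<lambda>j. recurrence_coeff r h j - y j"]) auto
  show "recurrence_coeff r h j = det (\<chi> i l. if l = index_at j
        then if index_pos i < r then h (index_pos i + r) else 0 else L $ i $ l) / det L"
    if "j < r" for j
    using eq[OF that] by (simp add: y_def x_def b_def cong: if_cong)
qed

lemma recurrence_coeff_cong:
  assumes "\<And>m. m < 2 * r \<Longrightarrow> h m = g m"
  shows "recurrence_coeff r h = recurrence_coeff r g"
proof -
  have "(\<Sum>j<r. h (i + j) * c j) = (\<Sum>j<r. g (i + j) * c j)" "h (i + r) = g (i + r)"
    if "i < r" for c i
    using assms that by auto
  then show ?thesis by (simp add: recurrence_coeff_def)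
qed

lemma nondegenerate_cong:
  assumes "\<And>m. m < 2 * r \<Longrightarrow> h m = g m"
  shows "nondegenerate r h \<longleftrightarrow> nondegenerate r g"
proof -
  have "(\<Sum>j<r. h (i + j) * c j) = (\<Sum>j<r. g (i + j) * c j)" if "i < r" for c i
    using assms that by auto
  then show ?thesis by (simp add: nondegenerate_def)
qed

lemma continuation_cong:
  assumes "\<And>m. m < 2 * r \<Longrightarrow> h m = g m"
  shows "continuation r h m = continuation r g m"
proof (induction m rule: less_induct)
  case (less m)
  have "recurrence_coeff r h = recurrence_coeff r g"
    by (rule recurrence_coeff_cong) (rule assms)
  then show ?case
    using assms less.IH
    by (auto simp: continuation.simps[of r _ m] intro!: sum.cong)
qed

lemma continuation_initial: "m < 2 * r \<Longrightarrow> continuation r h m = h m"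
  by (simp add: continuation.simps)

lemma continuation_recurrence:
  assumes "r \<le> CARD('n::{finite,linorder})" "nondegenerate r h"
  shows "continuation r h (m + r) = (\<Sum>j<r. continuation r h (m + j) * recurrence_coeff r h j)"
proof (cases "m < r")
  case True
  then show ?thesis
    using recurrence_coeff_cramer(1)[OF assms True] by (simp add: continuation_initial)
next
  case False
  then show ?thesis by (simp add: continuation.simps[of r h "m + r"])
qed

lemma continuation_unique:
  assumes "\<And>m. m + r < n \<Longrightarrow> h (m + r) = (\<Sum>j<r. h (m + j) * recurrence_coeff r h j)"
    and "m < n"
  shows "h m = continuation r h m"
  using assms(2)
proof (induction m rule: less_induct)
  case (less m)
  show ?case
  proof (cases "m < 2 * r")
    case False
    then have "h m = (\<Sum>j<r. h (m - r + j) * recurrence_coeff r h j)"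
      using assms(1)[of "m - r"] less.prems by simp
    also have "\<dots> = (\<Sum>j<r. continuation r h (m - r + j) * recurrence_coeff r h j)"
      using False less.prems by (intro sum.cong) (auto simp: less.IH)
    finally show ?thesis using False by (simp add: continuation.simps[of r h m])
  qed (simp add: continuation_initial)
qed

section \<open>Kernels and rank\<close>

text \<open>
  Here \<open>rank\<close> is the dimension of the row space, so left multiplication by row vectors is the map
  whose image has dimension \<open>rank A\<close>; it cannot be injective on a space of larger dimension.
\<close>
lemma exists_left_kernel_vector_in_span:
  fixes A :: "complex^'n^'m"
  assumes S: "vec.independent S" and less: "rank A < card S"
  obtains y where "y \<in> vec.span S" "y \<noteq> 0" "y v* A = 0"
proof -
  have "(\<lambda>y. y v* A) = (*v) (transpose A)" by (simp add: fun_eq_iff)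
  then interpret T: Vector_Spaces.linear "(*s)" "(*s)" "\<lambda>y. y v* A"
    using matrix_vector_mul_linear_gen[of "transpose A"] by metis
  have "\<exists>y\<in>vec.span S. y \<noteq> 0 \<and> y v* A = 0"
  proof (rule ccontr)
    assume no: "\<not> ?thesis"
    have inj: "inj_on (\<lambda>y. y v* A) (vec.span S)"
      using no T.inj_on_iff_eq_0[OF vec.subspace_span[of S]] by blast
    have "vec.independent ((\<lambda>y. y v* A) ` S)"
      using T.independent_injective_image[OF S inj] .
    moreover have "(\<lambda>y. y v* A) ` S \<subseteq> vec.span (rows A)"
    proof clarify
      fix y
      have "y v* A = (\<Sum>i\<in>UNIV. y $ i *s row i A)"
        by (simp add: vector_matrix_mult_def vec_eq_iff row_def mult.commute)
      also have "\<dots> \<in> vec.span (rows A)"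
        by (intro vec.span_sum vec.span_scale vec.span_base) (auto simp: rows_def)
      finally show "y v* A \<in> vec.span (rows A)" .
    qed
    ultimately have "card ((\<lambda>y. y v* A) ` S) \<le> rank A"
      unfolding row_rank_def_gen
      by (metis vec.dim_span vec.independent_card_le_dim)
    moreover have "card ((\<lambda>y. y v* A) ` S) = card S"
      using inj by (intro card_image) (meson inj_on_subset vec.span_superset)
    ultimately show False using less by simp
  qed
  then show ?thesis using that by blast
qed

lemma vec_independent_axes: "vec.independent ((\<lambda>j. axis j 1 :: complex^'n) ` J)"
  by (rule vec.independent_mono[OF independent_cart_basis]) (auto simp: cart_basis_def)

lemma card_axes: "card ((\<lambda>j. axis j 1 :: complex^'n) ` J) = card J"
  by (intro card_image inj_onI) (auto simp: axis_eq_axis)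

lemma span_axes_outside:
  assumes "x \<in> vec.span ((\<lambda>j. axis j 1 :: complex^'n) ` J)" "i \<notin> J"
  shows "x $ i = 0"
  using assms(1)
  by (induction rule: vec.span_induct_alt) (use assms(2) in \<open>auto simp: axis_def split: if_splits\<close>)

lemma card_le_rank:
  fixes A :: "complex^'n^'m"
  assumes "\<And>x. x v* A = 0 \<Longrightarrow> (\<And>j. j \<notin> J \<Longrightarrow> x $ j = 0) \<Longrightarrow> x = 0"
  shows "card J \<le> rank A"
proof (rule ccontr)
  assume "\<not> card J \<le> rank A"
  then obtain y where "y \<in> vec.span ((\<lambda>j. axis j 1) ` J)" "y \<noteq> 0" "y v* A = 0"
    using exists_left_kernel_vector_in_span[OF vec_independent_axes, of A J]
    by (auto simp: card_axes)
  with assms span_axes_outside show False by metis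
qed

section \<open>The strata as manifolds\<close>

text \<open>
  The antidiagonals of an \<open>n \<times> n\<close> matrix whose entries are unconstrained in the stratum with
  parameters \<open>r\<close> and \<open>s\<close>: the first \<open>2 * r\<close> and the last \<open>s\<close> of all \<open>2 * n - 1\<close>.
\<close>
definition free_index :: "nat \<Rightarrow> nat \<Rightarrow> nat \<Rightarrow> nat \<Rightarrow> bool" where
  "free_index n r s m \<longleftrightarrow> m < 2 * r \<or> 2 * n - 1 \<le> m + s"

text \<open>
  Hankel matrices whose symbol obeys the recurrence of order \<open>r\<close> set up by its first \<open>2 * r\<close> terms,
  except possibly in its last \<open>s\<close> terms. In terms of rational functions, there are \<open>r\<close> poles in
  the plane and a pole of order at most \<open>s\<close> at infinity.
\<close>
definition stratum :: "nat \<Rightarrow> nat \<Rightarrow> (complex^'n::{finite,linorder}^'n::{finite,linorder}) set" where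
  "stratum r s = {A. nondegenerate r (symbol A) \<and>
     A = hankel (\<lambda>m. if free_index CARD('n) r s m then symbol A m else continuation r (symbol A) m)}"

lemma C1_on_if:
  "(b \<Longrightarrow> C1_on f U) \<Longrightarrow> (\<not> b \<Longrightarrow> C1_on g U) \<Longrightarrow> C1_on (\<lambda>x. if b then f x else g x) U"
  by (cases b) simp_all

lemma C1_on_symbol: "C1_on (\<lambda>A. symbol A m) U"
  by (intro C1_on_bounded_linear bounded_linear_symbol)

lemma C1_on_leading_block_nth:
  "C1_on (\<lambda>A. (leading_block r (symbol A) :: complex^'n::{finite,linorder}^'n::{finite,linorder}) $ i $ j) U"
  unfolding leading_block_def vec_lambda_beta by (intro C1_on_if C1_on_symbol C1_on_const)

lemma C1_on_det_leading_block:
  "C1_on (\<lambda>A :: complex^'n::{finite,linorder}^'n::{finite,linorder}.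
     det (leading_block r (symbol A) :: complex^'n::{finite,linorder}^'n::{finite,linorder})) U"
  by (intro C1_on_det C1_on_leading_block_nth)

lemma open_nondegenerate:
  assumes "r \<le> CARD('n)"
  shows "open {A :: complex^'n::{finite,linorder}^'n::{finite,linorder}. nondegenerate r (symbol A)}"
  unfolding nondegenerate_iff_det[OF assms]
  by (intro open_Collect_neq C1_on_imp_continuous_on C1_on_det_leading_block continuous_on_const)

text \<open>
  The coefficients of the recurrence are rational by Cramer's rule, and each further term is a
  polynomial in them and in earlier terms.
\<close>
lemma C1_on_continuation:
  assumes "r \<le> CARD('n)"
  shows "C1_on (\<lambda>A. continuation r (symbol A) m)
    {A :: complex^'n::{finite,linorder}^'n::{finite,linorder}. nondegenerate r (symbol A)}"
    (is "C1_on _ ?U")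
proof -
  have coeff: "C1_on (\<lambda>A. recurrence_coeff r (symbol A) j) ?U" if "j < r" for j
  proof (rule C1_on_cong[OF _ open_nondegenerate[OF assms]])
    let ?L = "\<lambda>A. leading_block r (symbol (A :: complex^'n::{finite,linorder}^'n::{finite,linorder})) ::
      complex^'n::{finite,linorder}^'n::{finite,linorder}"
    show "C1_on (\<lambda>A. det (\<chi> i l. if l = index_at j
        then if index_pos i < r then symbol A (index_pos i + r) else 0 else ?L A $ i $ l) /
        det (?L A)) ?U"
      by (intro C1_on_divide C1_on_det C1_on_det_leading_block, unfold vec_lambda_beta)
        (auto simp: nondegenerate_iff_det[OF assms]
          intro!: C1_on_if C1_on_symbol C1_on_const C1_on_leading_block_nth)
  qed (use assms that in \<open>simp add: recurrence_coeff_cramer(2)[symmetric]\<close>)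
  show ?thesis
  proof (induction m rule: less_induct)
    case (less m)
    show ?case
    proof (cases "m < 2 * r")
      case True
      then show ?thesis by (simp add: continuation_initial C1_on_symbol)
    next
      case False
      then have "(\<lambda>A. continuation r (symbol A) m) =
        (\<lambda>A :: complex^'n::{finite,linorder}^'n::{finite,linorder}.
          \<Sum>j<r. continuation r (symbol A) (m - r + j) * recurrence_coeff r (symbol A) j)"
        by (simp add: fun_eq_iff continuation.simps[of r _ m])
      moreover have "m - r + j < m" if "j < r" for j
        using False that by simp
      ultimately show ?thesis
        by (auto intro!: C1_on_sum C1_on_mult less.IH coeff)
    qed
  qed
qed

text \<open>
  A stratum is the graph of the continued terms over the free ones, of which there are at most
  \<open>2 * r + s\<close> complex ones. The projection \<open>P\<close> retains the free antidiagonals and \<open>G\<close> fills in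
  the others.
\<close>
lemma manifold_stratum:
  assumes "r < CARD('n)"
  shows "\<exists>d\<le>2 * (2 * r + s).
    manifold d (stratum r s :: (complex^'n::{finite,linorder}^'n::{finite,linorder}) set)"
proof -
  let ?free = "free_index CARD('n) r s"
  define P G :: "complex^'n::{finite,linorder}^'n::{finite,linorder} \<Rightarrow> complex^'n::{finite,linorder}^'n::{finite,linorder}"
    where "P A = hankel (\<lambda>m. if ?free m then symbol A m else 0)"
      and "G A = hankel (\<lambda>m. if ?free m then 0 else continuation r (symbol A) m)" for A
  let ?U = "{A :: complex^'n::{finite,linorder}^'n::{finite,linorder}. nondegenerate r (symbol A)}"
  have symbol_P: "symbol (P A) m = symbol A m" if "m < 2 * r" for m A
    using that assms by (simp add: P_def symbol_hankel free_index_def)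
  have "linear P"
    by (rule linearI)
      (auto simp: P_def vec_eq_iff symbol_def)
  moreover have "P (P A) = P A" for A
    unfolding P_def[of "P A"] by (subst P_def, rule hankel_cong) (simp add: P_def symbol_hankel)
  moreover have "C1_on G ?U"
    unfolding G_def using assms
    by (intro C1_on_matrix, unfold hankel_nth)
      (intro C1_on_if C1_on_const C1_on_continuation, simp)
  moreover have "P A \<in> ?U \<longleftrightarrow> A \<in> ?U" for A
    using nondegenerate_cong[of r "symbol (P A)" "symbol A"] symbol_P by simp
  moreover have "G (P A) = G A" for A
  proof -
    have "continuation r (symbol (P A)) m = continuation r (symbol A) m" for m
      by (rule continuation_cong) (rule symbol_P)
    then show ?thesis by (simp add: G_def cong: if_cong)
  qed
  moreover have "P (G A) = 0" for A
  proof -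
    have "P (G A) = hankel (\<lambda>_. 0)"
      unfolding P_def by (rule hankel_cong) (simp add: G_def symbol_hankel)
    then show ?thesis by (simp add: vec_eq_iff)
  qed
  ultimately have "manifold (dim (range P)) {A\<in>?U. A = P A + G A}"
    using assms by (intro manifold_graph open_nondegenerate) auto
  moreover have "P A + G A = hankel (\<lambda>m. if ?free m then symbol A m else continuation r (symbol A) m)"
    for A
    by (simp add: P_def G_def vec_eq_iff)
  ultimately have "manifold (dim (range P))
      (stratum r s :: (complex^'n::{finite,linorder}^'n::{finite,linorder}) set)"
    by (simp add: stratum_def)
  \<comment> \<open>Every free antidiagonal contributes two real directions, with coefficients \<open>1\<close> and \<open>\<i>\<close>.\<close>
  moreover have "dim (range P) \<le> 2 * (2 * r + s)"
  proof -
    define E :: "complex \<Rightarrow> nat \<Rightarrow> complex^'n::{finite,linorder}^'n::{finite,linorder}"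
      where "E c m = hankel (\<lambda>l. if l = m then c else 0)" for c m
    define F where "F = {m. m < 2 * CARD('n) - 1 \<and> ?free m}"
    have "finite F" by (simp add: F_def)
    have "P A = (\<Sum>m\<in>F. Re (symbol A m) *\<^sub>R E 1 m + Im (symbol A m) *\<^sub>R E \<i> m)" for A
    proof -
      have "(\<Sum>m\<in>F. Re (symbol A m) *\<^sub>R E 1 m + Im (symbol A m) *\<^sub>R E \<i> m) $ i $ j = P A $ i $ j"
        for i j
      proof -
        have "(\<Sum>m\<in>F. Re (symbol A m) *\<^sub>R E 1 m + Im (symbol A m) *\<^sub>R E \<i> m) $ i $ j =
          (\<Sum>m\<in>F. if index_pos i + index_pos j = m then symbol A m else 0)"
          unfolding sum_component
          by (intro sum.cong) (auto simp: E_def complex_eq_iff)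
        also have "\<dots> = P A $ i $ j"
          using \<open>finite F\<close> index_pos_add_less[of i j] by (simp add: F_def P_def)
        finally show ?thesis .
      qed
      then show ?thesis by (simp add: vec_eq_iff)
    qed
    then have "range P \<subseteq> span (E 1 ` F \<union> E \<i> ` F)"
      by (auto intro!: span_sum span_add span_scale intro: span_base)
    then have "dim (range P) \<le> card (E 1 ` F \<union> E \<i> ` F)"
      using \<open>finite F\<close> by (intro dim_le_card) auto
    also have "\<dots> \<le> card F + card F"
      using \<open>finite F\<close> by (intro order.trans[OF card_Un_le] add_mono card_image_le)
    also have "card F \<le> card ({..<2 * r} \<union> {2 * CARD('n) - 1 - s..<2 * CARD('n) - 1})"
      by (intro card_mono) (auto simp: F_def free_index_def)
    then have "card F \<le> 2 * r + s"
      by (rule order.trans[OF _ order.trans[OF card_Un_le]]) simp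
    finally show ?thesis by simp
  qed
  ultimately show ?thesis by blast
qed

section \<open>Every Hankel matrix of small rank lies in a stratum\<close>

lemma vector_mult_hankel_nth:
  "(x v* (hankel h :: complex^'n::{finite,linorder}^'n::{finite,linorder})) $ i =
    (\<Sum>j<CARD('n). h (index_pos i + j) * x $ index_at j)"
proof -
  have "(x v* (hankel h :: complex^'n::{finite,linorder}^'n::{finite,linorder})) $ i =
      (\<Sum>j\<in>(UNIV :: 'n set). (\<lambda>m. h (index_pos i + m) * x $ index_at m) (index_pos j))"
    by (simp add: vector_matrix_mult_def mult.commute add.commute)
  also have "\<dots> = (\<Sum>j<CARD('n). h (index_pos i + j) * x $ index_at j)"
    by (rule sum_index_pos)
  finally show ?thesis .
qed

lemma hankel_in_stratum:
  assumes "r < CARD('n)" "nondegenerate r h"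
    and "\<And>m. m + s < 2 * CARD('n) - 1 \<Longrightarrow> h m = continuation r h m"
  shows "hankel h \<in> (stratum r s :: (complex^'n::{finite,linorder}^'n::{finite,linorder}) set)"
proof -
  let ?A = "hankel h :: complex^'n::{finite,linorder}^'n::{finite,linorder}"
  have sym: "symbol ?A m = h m" if "m < 2 * CARD('n) - 1" for m
    using that by (rule symbol_hankel)
  then have cont: "continuation r (symbol ?A) m = continuation r h m" for m
    using assms(1) by (intro continuation_cong) simp
  moreover have "nondegenerate r (symbol ?A)"
    using assms(1,2) nondegenerate_cong[of r "symbol ?A" h] sym by simp
  moreover have "?A = hankel (\<lambda>m. if free_index CARD('n) r s m then symbol ?A m
      else continuation r (symbol ?A) m)"
    by (rule hankel_cong) (auto simp: free_index_def sym cont assms(3))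
  ultimately show ?thesis unfolding stratum_def by blast
qed

text \<open>
  Let \<open>e\<close> be the error in the recurrence with coefficients \<open>c\<close>, and \<open>t\<close> the position of the first
  error. If \<open>x\<close> is in the kernel of the \<open>n \<times> n\<close> Hankel block of \<open>h\<close>, subtracting from each row the
  combination of \<open>r\<close> earlier rows prescribed by \<open>c\<close> shows that \<open>x\<close> is in the kernel of the Hankel
  block of \<open>e\<close> with \<open>n - r\<close> rows. This block vanishes above the antidiagonal \<open>t\<close> and has the nonzero
  constant \<open>e t\<close> on it, so the entries of \<open>x\<close> met by this antidiagonal vanish, the last one first.
\<close>
lemma kernel_vanishes_at_high_positions:
  fixes h c x :: "nat \<Rightarrow> complex" and r :: nat
  defines "e \<equiv> \<lambda>m. h (m + r) - (\<Sum>l<r. h (m + l) * c l)"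
  assumes e0: "\<And>m. m < t \<Longrightarrow> e m = 0" and et: "e t \<noteq> 0" and n: "n \<le> t + 1"
    and ker: "\<And>i. i < n \<Longrightarrow> (\<Sum>j<n. h (i + j) * x j) = 0"
  shows "j < n \<Longrightarrow> t + r < j + n \<Longrightarrow> x j = 0"
proof (induction "n - j" arbitrary: j rule: less_induct)
  case less
  \<comment> \<open>In row \<open>t - j\<close> the position \<open>j\<close> lies on the antidiagonal \<open>t\<close>.\<close>
  define i where "i = t - j"
  have i: "i + j = t" "i + r < n" using less.prems n by (auto simp: i_def)
  have "(\<Sum>j'<n. e (i + j') * x j') =
      (\<Sum>j'<n. h ((i + r) + j') * x j') - (\<Sum>j'<n. \<Sum>l<r. c l * (h ((i + l) + j') * x j'))"
    by (simp add: e_def right_diff_distrib left_diff_distrib sum_subtractf sum_distrib_left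
        sum_distrib_right ac_simps)
  also have "(\<Sum>j'<n. \<Sum>l<r. c l * (h ((i + l) + j') * x j')) =
      (\<Sum>l<r. c l * (\<Sum>j'<n. h ((i + l) + j') * x j'))"
    by (subst sum.swap) (simp add: sum_distrib_left)
  also have "\<dots> = 0"
    using i(2) by (intro sum.neutral) (simp add: ker)
  also have "(\<Sum>j'<n. h ((i + r) + j') * x j') = 0"
    using i(2) by (rule ker)
  finally have "0 = (\<Sum>j'<n. e (i + j') * x j')" by simp
  also have "\<dots> = (\<Sum>j'<n. if j' = j then e t * x j else 0)"
  proof (intro sum.cong refl)
    fix j' assume "j' \<in> {..<n}"
    then consider "j' < j" | "j' = j" | "j < j'" "j' < n" by fastforce
    then show "e (i + j') * x j' = (if j' = j then e t * x j else 0)"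
    proof cases
      case 1
      then show ?thesis using i(1) e0[of "i + j'"] by simp
    next
      case 3
      then show ?thesis using less.hyps[of j'] less.prems by simp
    qed (use i(1) in simp)
  qed
  also have "\<dots> = e t * x j" using less.prems by simp
  finally show ?case using et by simp
qed

text \<open>
  Take \<open>r\<close> as large as possible such that the leading \<open>r \<times> r\<close> block is regular, and let \<open>t\<close> be the
  position of the first failure of its recurrence, that is, \<open>t + r\<close> is the index of the first wrong
  term. If \<open>t < N\<close>, then by the preceding lemma the leading block of order \<open>t + 1\<close> would be regular,
  against the choice of \<open>r\<close>. So only the last \<open>s = 2 * N - 1 - (t + r)\<close> terms are arbitrary (none
  if the recurrence never fails), and the same lemma applied to the whole matrix shows that the
  rows at the first \<open>r\<close> and the last \<open>s\<close> positions are independent; hence \<open>r + s\<close> is at most the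
  rank.
\<close>
lemma hankel_rank_le_covered:
  fixes A :: "complex^'n::{finite,linorder}^'n::{finite,linorder}"
  assumes A: "A \<in> hankel_rank_le k" and k: "k < CARD('n)"
  shows "\<exists>r s. r + s \<le> k \<and> A \<in> stratum r s"
proof -
  let ?N = "CARD('n)"
  define h where "h = symbol A"
  have A_eq: "A = hankel h" and rank: "rank A \<le> k"
    using A by (auto simp: h_def hankel_rank_le_def rank_le_matrices_def hankel_symbol)
  \<comment> \<open>The bound on the rank, in terms of sequences instead of vectors.\<close>
  have support_le_rank: "card J \<le> k"
    if "\<And>x. (\<And>i. i < ?N \<Longrightarrow> (\<Sum>j<?N. h (i + j) * x j) = 0) \<Longrightarrow>
      (\<And>j. j < ?N \<Longrightarrow> j \<notin> J \<Longrightarrow> x j = 0) \<Longrightarrow> \<forall>j<?N. x j = 0" and "J \<subseteq> {..<?N}" for J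
  proof -
    have "card ((index_at :: nat \<Rightarrow> 'n) ` J) = card J"
      using that(2) by (intro card_image inj_onI) (metis index_pos_index_at lessThan_iff subsetD)
    moreover have "card ((index_at :: nat \<Rightarrow> 'n) ` J) \<le> rank A"
    proof (rule card_le_rank)
      fix x assume "x v* A = 0" and out: "\<And>i. i \<notin> index_at ` J \<Longrightarrow> x $ i = 0"
      then have "(\<Sum>j<?N. h (i + j) * x $ index_at j) = 0" if "i < ?N" for i
        using that vector_mult_hankel_nth[of x h "index_at i"] by (simp add: A_eq)
      moreover have "x $ index_at j = 0" if "j < ?N" "j \<notin> J" for j
        using that \<open>J \<subseteq> {..<?N}\<close>
        by (intro out) (metis image_iff index_pos_index_at lessThan_iff subsetD)
      ultimately have "\<forall>j<?N. x $ index_at j = 0"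
        using that(1)[of "\<lambda>j. x $ index_at j"] by blast
      then show "x = 0"
        by (metis index_at_index_pos index_pos_less_CARD vec_eq_iff zero_index)
    qed
    ultimately show ?thesis using rank by simp
  qed
  have "\<exists>r. (r \<le> ?N \<and> nondegenerate r h) \<and> (\<forall>r'. r' \<le> ?N \<and> nondegenerate r' h \<longrightarrow> r' \<le> r)"
    by (rule ex_has_greatest_nat[of _ 0 _ "?N + 1"])
      (auto simp: nondegenerate_def less_Suc_eq_le)
  then obtain r where r: "r \<le> ?N" "nondegenerate r h"
    and r_max: "\<And>r'. r' \<le> ?N \<Longrightarrow> nondegenerate r' h \<Longrightarrow> r' \<le> r"
    by blast
  have block_kernel: "\<forall>j<n. x j = 0"
    if "\<And>i. i < n \<Longrightarrow> (\<Sum>j<n. h (i + j) * x j) = 0" "\<And>j. r \<le> j \<Longrightarrow> j < n \<Longrightarrow> x j = 0" "r \<le> n"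
    for x n
  proof -
    have "(\<Sum>j<r. h (i + j) * x j) = (\<Sum>j<n. h (i + j) * x j)" for i
      using that(2,3) by (intro sum.mono_neutral_left) auto
    with that r(2) have "\<forall>j<r. x j = 0"
      unfolding nondegenerate_def by (metis order.strict_trans2)
    with that(2) show ?thesis by (metis not_less)
  qed
  have "r \<le> k"
    using support_le_rank[of "{..<r}"] block_kernel[of ?N] r(1) by force
  define c where "c = recurrence_coeff r h"
  define e where "e = (\<lambda>m. h (m + r) - (\<Sum>l<r. h (m + l) * c l))"
  have e_init: "e m = 0" if "m < r" for m
    using recurrence_coeff_cramer(1)[OF r that] by (simp add: e_def c_def)
  have agree: "h m = continuation r h m" if "\<And>m. m + r < n \<Longrightarrow> e m = 0" "m < n" for m n
    using that by (intro continuation_unique[of r n]) (auto simp: e_def c_def)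
  show ?thesis
  proof (cases "\<forall>m. m + r < 2 * ?N - 1 \<longrightarrow> e m = 0")
    case True
    then have "hankel h \<in> (stratum r 0 :: (complex^'n::{finite,linorder}^'n::{finite,linorder}) set)"
      using \<open>r \<le> k\<close> k r(2) by (intro hankel_in_stratum agree) auto
    with \<open>r \<le> k\<close> A_eq show ?thesis by (intro exI[of _ r] exI[of _ 0]) simp
  next
    case False
    define t where "t = (LEAST m. e m \<noteq> 0)"
    obtain m where m: "m + r < 2 * ?N - 1" "e m \<noteq> 0" using False by blast
    have et: "e t \<noteq> 0" unfolding t_def using m(2) by (rule LeastI)
    have e0: "e m = 0" if "m < t" for m using not_less_Least that unfolding t_def by blast
    have "t + r < 2 * ?N - 1" using Least_le[of "\<lambda>m. e m \<noteq> 0", OF m(2)] m(1) by (simp add: t_def)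
    have "r \<le> t" using e_init et by (meson not_less)
    have high: "x j = 0" if "n \<le> t + 1" "\<And>i. i < n \<Longrightarrow> (\<Sum>j<n. h (i + j) * x j) = 0"
      "j < n" "t + r < j + n" for x n j
      using kernel_vanishes_at_high_positions[of t h r c n x j] that e0 et unfolding e_def by blast
    have "?N \<le> t"
    proof (rule ccontr)
      assume "\<not> ?N \<le> t"
      have "nondegenerate (t + 1) h"
        unfolding nondegenerate_def
      proof (rule allI, rule impI)
        fix x assume x: "\<forall>i<t + 1. (\<Sum>j<t + 1. h (i + j) * x j) = 0"
        have "x j = 0" if "r \<le> j" "j < t + 1" for j
          using x that by (intro high[of "t + 1" x j]) auto
        with x \<open>r \<le> t\<close> show "\<forall>j<t + 1. x j = 0"
          by (intro block_kernel) auto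
      qed
      with r_max[of "t + 1"] \<open>\<not> ?N \<le> t\<close> \<open>r \<le> t\<close> show False by simp
    qed
    define s where "s = 2 * ?N - 1 - (t + r)"
    have s: "s \<le> ?N - 1 - r" "t + r + s = 2 * ?N - 1"
      using \<open>?N \<le> t\<close> \<open>t + r < 2 * ?N - 1\<close> by (auto simp: s_def)
    define J where "J = {..<r} \<union> {?N - s..<?N}"
    have "card J = r + s"
      unfolding J_def using s \<open>r \<le> k\<close> k by (subst card_Un_disjoint) auto
    moreover have "card J \<le> k"
    proof (rule support_le_rank)
      fix x assume x: "\<And>i. i < ?N \<Longrightarrow> (\<Sum>j<?N. h (i + j) * x j) = 0"
        and out: "\<And>j. j < ?N \<Longrightarrow> j \<notin> J \<Longrightarrow> x j = 0"
      have "x j = 0" if "r \<le> j" "j < ?N" for j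
      proof (cases "j < ?N - s")
        case True
        with that show ?thesis by (intro out) (auto simp: J_def)
      next
        case False
        with that s x \<open>?N \<le> t\<close> show ?thesis by (intro high[of ?N x j]) auto
      qed
      with x r(1) show "\<forall>j<?N. x j = 0" by (intro block_kernel) auto
    qed (use r(1) in \<open>auto simp: J_def\<close>)
    moreover have "hankel h \<in> (stratum r s :: (complex^'n::{finite,linorder}^'n::{finite,linorder}) set)"
      using \<open>r \<le> k\<close> k r(2) s e0 by (intro hankel_in_stratum agree[of "t + r"]) auto
    ultimately show ?thesis using A_eq by (intro exI[of _ r] exI[of _ s]) simp
  qed
qed

section \<open>Tangent spaces at generic points\<close>

lemma tangent_space_mono: "M \<subseteq> M' \<Longrightarrow> tangent_space M A \<subseteq> tangent_space M' A"
  unfolding tangent_space_def by blast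

text \<open>
  The velocity of a curve in a linear subspace stays in the subspace.
\<close>
lemma tangent_space_hankel_matrices:
  fixes A :: "complex^'n::{finite,linorder}^'n::{finite,linorder}"
  shows "tangent_space hankel_matrices A \<subseteq> hankel_matrices"
proof
  fix B assume "B \<in> tangent_space hankel_matrices A"
  then obtain \<gamma> e where \<gamma>: "0 < e" "\<gamma> ` {-e<..<e} \<subseteq> hankel_matrices"
    "(\<gamma> has_vector_derivative B) (at (0::real))"
    unfolding tangent_space_def by blast
  have deriv: "((\<lambda>t. \<gamma> t $ j $ l) has_vector_derivative B $ j $ l) (at 0)" for j l
    by (intro bounded_linear.has_vector_derivative[OF bounded_linear_vec_nth] \<gamma>(3))
  show "B \<in> hankel_matrices"
    unfolding hankel_matrices_def mem_Collect_eq
  proof (intro allI impI)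
    fix j l j' l' :: 'n assume eq: "index_pos j + index_pos l = index_pos j' + index_pos l'"
    have "\<gamma> t $ j $ l = \<gamma> t $ j' $ l'" if "t \<in> {-e<..<e}" for t
    proof -
      have "\<gamma> t \<in> hankel_matrices" using \<gamma>(2) that by blast
      with eq show ?thesis unfolding hankel_matrices_def mem_Collect_eq by blast
    qed
    with \<gamma>(1) have "((\<lambda>t. \<gamma> t $ j' $ l') has_vector_derivative B $ j $ l) (at 0)"
      by (intro has_vector_derivative_transform_within_open[OF deriv[of j l], of "{-e<..<e}"]) auto
    then show "B $ j $ l = B $ j' $ l'" using deriv[of j' l'] by (rule vector_derivative_unique_at)
  qed
qed

lemma has_vector_derivative_imp_quotient_tendsto:
  fixes \<gamma> :: "real \<Rightarrow> 'a::real_normed_vector"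
  assumes "(\<gamma> has_vector_derivative B) (at 0)"
  shows "((\<lambda>t. (\<gamma> t - \<gamma> 0) /\<^sub>R t) \<longlongrightarrow> B) (at 0)"
proof -
  have "(\<lambda>t. norm (\<gamma> t - \<gamma> 0 - t *\<^sub>R B) / norm t) \<midarrow>0\<rightarrow> 0"
    using assms by (simp add: has_vector_derivative_def has_derivative_at)
  then have "(\<lambda>t. norm ((\<gamma> t - \<gamma> 0) /\<^sub>R t - B)) \<midarrow>0\<rightarrow> 0"
  proof (rule Lim_transform_eventually)
    show "\<forall>\<^sub>F t in at 0. norm (\<gamma> t - \<gamma> 0 - t *\<^sub>R B) / norm t = norm ((\<gamma> t - \<gamma> 0) /\<^sub>R t - B)"
      unfolding eventually_at_filter
    proof (intro always_eventually allI impI)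
      fix t :: real assume "t \<noteq> 0"
      then have "(\<gamma> t - \<gamma> 0) /\<^sub>R t - B = (\<gamma> t - \<gamma> 0 - t *\<^sub>R B) /\<^sub>R t"
        by (simp add: scaleR_diff_right)
      then show "norm (\<gamma> t - \<gamma> 0 - t *\<^sub>R B) / norm t = norm ((\<gamma> t - \<gamma> 0) /\<^sub>R t - B)"
        by (simp add: divide_inverse mult.commute)
    qed
  qed
  then show ?thesis by (simp add: tendsto_norm_zero_iff Lim_null[of _ B])
qed

lemma closed_vec_span: "closed (vec.span S :: (complex^'n) set)"
proof (rule closed_subspace)
  have scaleR: "c *\<^sub>R x = complex_of_real c *s x" for c and x :: "complex^'n"
    by (simp add: vec_eq_iff scaleR_conv_of_real[where 'a = complex])
  show "subspace (vec.span S :: (complex^'n) set)"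
    unfolding subspace_def scaleR
    by (auto intro: vec.span_zero vec.span_add vec.span_scale)
qed

text \<open>
  The second-order condition on the tangent vectors of the matrices of bounded rank at a point \<open>A\<close> of
  exact rank \<open>k\<close>, in the form \<open>w\<^sup>T B u = 0\<close> for \<open>w\<close> and \<open>u\<close> in the left and right kernel of \<open>A\<close>.
  Left multiplication by \<open>A\<close> is injective on the coordinate space of \<open>J\<close>, but by the bound on the
  rank no matrix \<open>\<gamma> t\<close> on a curve is left injective on the larger space spanned also by \<open>w\<close>. So
  there are unit vectors \<open>y\<close> in this space with \<open>y\<^sup>T \<gamma> t = 0\<close>. By compactness they accumulate as
  \<open>t \<rightarrow> 0\<close>, and a limit is annihilated by \<open>A\<close>, so it is a multiple of \<open>w\<close>. Since \<open>A u = 0\<close>,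
  also \<open>y\<^sup>T ((\<gamma> t - A) / t) u = 0\<close>, and the limit of this equation is the claim.
\<close>
lemma tangent_rank_le_matrices_kernels:
  fixes A B :: "complex^'n^'n"
  assumes B: "B \<in> tangent_space (rank_le_matrices k) A"
    and J: "card J = k" "\<And>x. x v* A = 0 \<Longrightarrow> (\<And>j. j \<notin> J \<Longrightarrow> x $ j = 0) \<Longrightarrow> x = 0"
    and w: "w v* A = 0" and u: "A *v u = 0"
  shows "(\<Sum>i\<in>UNIV. w $ i * (B *v u) $ i) = 0"
proof (cases "w = 0")
  case False
  define pair where "pair y M = (\<Sum>i\<in>UNIV. y $ i * (M *v u) $ i)" for y and M :: "complex^'n^'n"
  have pair_v: "pair y M = (\<Sum>j\<in>UNIV. (y v* M) $ j * u $ j)" for y M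
  proof -
    have "pair y M = (\<Sum>i\<in>UNIV. \<Sum>j\<in>UNIV. y $ i * M $ i $ j * u $ j)"
      by (simp add: pair_def matrix_vector_mult_def sum_distrib_left mult.assoc)
    also have "\<dots> = (\<Sum>j\<in>UNIV. \<Sum>i\<in>UNIV. y $ i * M $ i $ j * u $ j)" by (rule sum.swap)
    finally show ?thesis
      by (simp add: vector_matrix_mult_def sum_distrib_right mult.commute[of "M $ _ $ _"])
  qed
  have pair_tendsto: "((\<lambda>n. pair (y n) (M n)) \<longlongrightarrow> pair y' M') F"
    if "(y \<longlongrightarrow> y') F" "(M \<longlongrightarrow> M') F" for y M y' M' and F :: "nat filter"
    unfolding pair_def matrix_vector_mult_def vec_lambda_beta
    by (intro tendsto_intros that)
  define S where "S = (\<lambda>j. axis j 1 :: complex^'n) ` J"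
  have "w \<notin> vec.span S"
    using J(2)[OF w] False span_axes_outside unfolding S_def by blast
  then have indep: "vec.independent (insert w S)"
    unfolding S_def by (intro vec.independent_insertI vec_independent_axes)
  have "card (insert w S) = k + 1"
    using \<open>w \<notin> vec.span S\<close> vec.span_base[of w S] J(1)
    by (subst card_insert_disjoint) (auto simp: S_def card_axes)
  obtain \<gamma> e where \<gamma>: "0 < e" "\<gamma> ` {-e<..<e} \<subseteq> rank_le_matrices k" "\<gamma> 0 = A"
    "(\<gamma> has_vector_derivative B) (at (0::real))"
    using B unfolding tangent_space_def by blast
  \<comment> \<open>A null sequence of nonzero parameters; the shift by two keeps it below \<open>e\<close> from the start.\<close>
  define t where "t n = e * inverse (real (Suc (Suc n)))" for n
  have t_pos: "t n \<noteq> 0" "t n \<in> {-e<..<e}" for n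
  proof -
    have "0 < inverse (real (Suc (Suc n)))" "inverse (real (Suc (Suc n))) < 1"
      by (auto simp: field_simps)
    with \<gamma>(1) show "t n \<noteq> 0" "t n \<in> {-e<..<e}"
      using mult_strict_left_mono[of _ 1 e] mult_pos_pos[of e] by (fastforce simp: t_def)+
  qed
  have t_lim: "t \<longlonglongrightarrow> 0"
    unfolding t_def using tendsto_mult_right_zero[OF LIMSEQ_Suc[OF LIMSEQ_inverse_real_of_nat]] by blast
  have "\<exists>y. y \<in> vec.span (insert w S) \<and> norm y = 1 \<and> y v* \<gamma> (t n) = 0" for n
  proof -
    have "rank (\<gamma> (t n)) < card (insert w S)"
      using \<gamma>(2) t_pos(2)[of n] \<open>card (insert w S) = k + 1\<close>
      by (auto simp: rank_le_matrices_def image_subset_iff less_Suc_eq_le)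
    from exists_left_kernel_vector_in_span[OF indep this]
    obtain y where y: "y \<in> vec.span (insert w S)" "y \<noteq> 0" "y v* \<gamma> (t n) = 0" .
    define c where "c = complex_of_real (inverse (norm y))"
    have "c *s y = inverse (norm y) *\<^sub>R y" by (simp add: vec_eq_iff c_def scaleR_conv_of_real[where 'a = complex])
    then have "norm (c *s y) = 1" using y(2) by simp
    moreover have "(c *s y) v* \<gamma> (t n) = c *s (y v* \<gamma> (t n))"
      by (simp add: vec_eq_iff vector_matrix_mult_def sum_distrib_left ac_simps)
    ultimately show ?thesis
      using y by (intro exI[of _ "c *s y"]) (simp add: vec.span_scale)
  qed
  then obtain y where y: "\<And>n. y n \<in> vec.span (insert w S)" "\<And>n. norm (y n) = 1"
    "\<And>n. y n v* \<gamma> (t n) = 0"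
    by metis
  have "compact (sphere 0 1 \<inter> vec.span (insert w S))"
    by (intro compact_Int_closed closed_vec_span) simp
  then obtain y' and f :: "nat \<Rightarrow> nat" where y': "y' \<in> sphere 0 1 \<inter> vec.span (insert w S)"
    and "strict_mono f" and y_lim: "(y \<circ> f) \<longlonglongrightarrow> y'"
    using y(1,2) unfolding compact_def by (metis IntI dist_0_norm mem_sphere)
  have tf_lim: "(t \<circ> f) \<longlonglongrightarrow> 0"
    using t_lim \<open>strict_mono f\<close> by (rule LIMSEQ_subseq_LIMSEQ)
  have \<gamma>_lim: "(\<lambda>n. \<gamma> (t (f n))) \<longlonglongrightarrow> A"
    using has_vector_derivative_continuous[OF \<gamma>(4)] tf_lim \<gamma>(3)
    by (auto simp: o_def dest: isCont_tendsto_compose)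
  have quot_lim: "(\<lambda>n. (\<gamma> (t (f n)) - A) /\<^sub>R t (f n)) \<longlonglongrightarrow> B"
    using has_vector_derivative_imp_quotient_tendsto[OF \<gamma>(4)] tf_lim t_pos(1)
    unfolding tendsto_at_iff_sequentially \<gamma>(3) by (force simp: o_def)
  have "y' v* A = 0"
  proof -
    have "(\<lambda>n. ((y \<circ> f) n v* \<gamma> (t (f n))) $ j) \<longlonglongrightarrow> (y' v* A) $ j" for j
      unfolding vector_matrix_mult_def vec_lambda_beta
      by (intro tendsto_intros y_lim \<gamma>_lim)
    then have "(y' v* A) $ j = 0" for j
      using y(3) by (simp add: LIMSEQ_const_iff)
    then show ?thesis by (simp add: vec_eq_iff)
  qed
  obtain a where a: "y' - a *s w \<in> vec.span S"
    using y' by (auto simp: vec.span_breakdown_eq)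
  have "(y' - a *s w) v* A = (y' v* A) - a *s (w v* A)"
    by (simp add: vec_eq_iff vector_matrix_mult_def sum_distrib_left algebra_simps sum_subtractf)
  then have "(y' - a *s w) v* A = 0" using \<open>y' v* A = 0\<close> w by simp
  moreover have "(y' - a *s w) $ j = 0" if "j \<notin> J" for j
    using a that unfolding S_def by (rule span_axes_outside)
  ultimately have "y' - a *s w = 0" by (rule J(2))
  then have "y' = a *s w" by simp
  with y' have "a \<noteq> 0" by auto
  have "pair (y (f n)) ((\<gamma> (t (f n)) - A) /\<^sub>R t (f n)) = 0" for n
  proof -
    have "((X /\<^sub>R c) *v u) $ i = (X *v u) $ i /\<^sub>R c" for X :: "complex^'n^'n" and c i
      by (simp add: matrix_vector_mult_def scaleR_sum_right)
    then have "pair (y (f n)) ((\<gamma> (t (f n)) - A) /\<^sub>R t (f n)) =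
        pair (y (f n)) (\<gamma> (t (f n)) - A) /\<^sub>R t (f n)"
      by (simp add: pair_def scaleR_sum_right)
    also have "pair (y (f n)) (\<gamma> (t (f n)) - A) =
        pair (y (f n)) (\<gamma> (t (f n))) - pair (y (f n)) A"
      by (simp add: pair_def matrix_vector_mult_diff_rdistrib right_diff_distrib sum_subtractf)
    also have "pair (y (f n)) (\<gamma> (t (f n))) = 0" by (simp add: pair_v y(3))
    also have "pair (y (f n)) A = 0" by (simp add: pair_def u)
    finally show ?thesis by simp
  qed
  then have "pair y' B = 0"
    using pair_tendsto[OF y_lim quot_lim] by (simp add: LIMSEQ_const_iff)
  moreover have "pair y' B = a * pair w B"
    by (simp add: \<open>y' = a *s w\<close> pair_def sum_distrib_left mult.assoc)
  ultimately show ?thesis using \<open>a \<noteq> 0\<close> by (simp add: pair_def)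
qed simp

text \<open>
  By the recurrence every row is a combination of the \<open>k\<close> rows before it.
\<close>
lemma rank_hankel_continuation:
  assumes "k \<le> CARD('n)" "nondegenerate k h"
  shows "rank (hankel (continuation k h) :: complex^'n::{finite,linorder}^'n::{finite,linorder}) \<le> k"
proof -
  let ?A = "hankel (continuation k h) :: complex^'n::{finite,linorder}^'n::{finite,linorder}"
  define R where "R m = (\<chi> j::'n. continuation k h (m + index_pos j))" for m
  have "R m \<in> vec.span (R ` {..<k})" for m
  proof (induction m rule: less_induct)
    case (less m)
    show ?case
    proof (cases "m < k")
      case False
      have "R m = (\<Sum>l<k. recurrence_coeff k h l *s R (m - k + l))"
      proof (subst vec_eq_iff, rule allI)
        fix j
        have "R m $ j = continuation k h ((m - k + index_pos j) + k)"
          using False by (simp add: R_def)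
        also have "\<dots> = (\<Sum>l<k. recurrence_coeff k h l * R (m - k + l) $ j)"
          by (subst continuation_recurrence[OF assms]) (simp add: R_def ac_simps)
        finally show "R m $ j = (\<Sum>l<k. recurrence_coeff k h l *s R (m - k + l)) $ j" by simp
      qed
      also have "\<dots> \<in> vec.span (R ` {..<k})"
        using False by (intro vec.span_sum vec.span_scale less.IH) auto
      finally show ?thesis .
    qed (auto intro: vec.span_base)
  qed
  moreover have "row i ?A = R (index_pos i)" for i
    by (simp add: row_def R_def vec_eq_iff)
  ultimately have "rows ?A \<subseteq> vec.span (R ` {..<k})" by (auto simp: rows_def)
  then have "rank ?A \<le> card (R ` {..<k})"
    unfolding row_rank_def_gen by (intro vec.dim_le_card) auto
  also have "\<dots> \<le> k" using card_image_le[of "{..<k}" R] by simp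
  finally show ?thesis .
qed

text \<open>
  Pairing a sequence with the coefficients of \<open>z\<^sup>m q(z)\<close>, where \<open>q\<close> has degree at most \<open>k\<close>.
\<close>
lemma sum_shifted_support:
  fixes q g :: "nat \<Rightarrow> complex"
  assumes "m + k < n" "\<And>i. k < i \<Longrightarrow> q i = 0"
  shows "(\<Sum>j<n. (if m \<le> j then q (j - m) else 0) * g j) = (\<Sum>i\<le>k. q i * g (i + m))"
proof -
  have "(\<Sum>j<n. (if m \<le> j then q (j - m) else 0) * g j) =
      (\<Sum>j\<in>{m..m + k}. (if m \<le> j then q (j - m) else 0) * g j)"
    using assms by (intro sum.mono_neutral_right) auto
  also have "\<dots> = (\<Sum>i\<le>k. q i * g (i + m))"
    by (rule sum.reindex_bij_witness[of _ "\<lambda>i. i + m" "\<lambda>j. j - m"]) auto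
  finally show ?thesis .
qed

text \<open>
  A functional on polynomials of degree less than \<open>n\<close> that vanishes on the multiples of \<open>q\<^sup>2\<close> is
  determined by its first \<open>2 * k\<close> moments if \<open>q\<close> is monic of degree \<open>k\<close>, since then \<open>q\<^sup>2\<close> is monic of
  degree \<open>2 * k\<close>.
\<close>
lemma zero_if_annihilated_by_square:
  fixes q d :: "nat \<Rightarrow> complex"
  assumes "q k = 1" and init: "\<And>m. m < 2 * k \<Longrightarrow> d m = 0"
    and square: "\<And>p. p + 2 * k < n \<Longrightarrow> (\<Sum>i\<le>k. \<Sum>j\<le>k. q i * q j * d (i + j + p)) = 0"
    and "m < n"
  shows "d m = 0"
  using \<open>m < n\<close>
proof (induction m rule: less_induct)
  case (less m)
  show ?case
  proof (cases "m < 2 * k")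
    case False
    define p where "p = m - 2 * k"
    have m: "m = p + 2 * k" using False by (simp add: p_def)
    then have top: "k + k + p = m" by simp
    have "0 = (\<Sum>i\<le>k. \<Sum>j\<le>k. q i * q j * d (i + j + p))"
      using square less.prems m by simp
    also have "\<dots> = (\<Sum>i\<le>k. \<Sum>j\<le>k. if i = k then if j = k then d m else 0 else 0)"
    proof (intro sum.cong refl)
      fix i j assume "i \<in> {..k}" "j \<in> {..k}"
      then have "d (i + j + p) = 0" if "i \<noteq> k \<or> j \<noteq> k"
        using that less.prems m by (intro less.IH) auto
      then show "q i * q j * d (i + j + p) = (if i = k then if j = k then d m else 0 else 0)"
        using \<open>q k = 1\<close> top by auto
    qed
    also have "\<dots> = (\<Sum>i\<le>k. if i = k then d m else 0)"
      by (intro sum.cong refl) simp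
    also have "\<dots> = d m" by simp
    finally show ?thesis by simp
  qed (rule init)
qed

text \<open>
  The coefficients of the polynomial \<open>z\<^sup>r - (\<Sum>j<r. c\<^sub>j z\<^sup>j)\<close> of the recurrence.
\<close>
definition recurrence_poly :: "nat \<Rightarrow> (nat \<Rightarrow> complex) \<Rightarrow> nat \<Rightarrow> complex" where
  "recurrence_poly r h i = (if i = r then 1 else if i < r then - recurrence_coeff r h i else 0)"

lemma recurrence_poly_annihilates_continuation:
  assumes "r \<le> CARD('n::{finite,linorder})" "nondegenerate r h"
  shows "(\<Sum>i\<le>r. recurrence_poly r h i * continuation r h (i + p)) = 0"
proof -
  have "(\<Sum>i\<le>r. recurrence_poly r h i * continuation r h (i + p)) =
      continuation r h (r + p) + (\<Sum>i<r. recurrence_poly r h i * continuation r h (i + p))"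
    by (simp add: lessThan_Suc_atMost[symmetric] recurrence_poly_def)
  also have "(\<Sum>i<r. recurrence_poly r h i * continuation r h (i + p)) =
      - (\<Sum>i<r. continuation r h (p + i) * recurrence_coeff r h i)"
    unfolding sum_negf[symmetric] by (intro sum.cong) (auto simp: recurrence_poly_def ac_simps)
  finally show ?thesis
    using continuation_recurrence[OF assms, of p] by (simp add: ac_simps)
qed

lemma generic_stratum_eq_hankel_continuation:
  fixes A :: "complex^'n::{finite,linorder}^'n::{finite,linorder}"
  assumes "A \<in> stratum k 0"
  shows "A = hankel (continuation k (symbol A))"
proof -
  have "A = hankel (\<lambda>m. if free_index CARD('n) k 0 m then symbol A m else continuation k (symbol A) m)"
    using assms unfolding stratum_def by blast
  also have "\<dots> = hankel (continuation k (symbol A))"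
    by (rule hankel_cong) (auto simp: free_index_def continuation_initial)
  finally show ?thesis .
qed

text \<open>
  The kernel of \<open>A\<close> consists of the coefficient vectors of the multiples of the polynomial \<open>q\<close> of the
  recurrence. Its elements \<open>z\<^sup>m q\<close> and \<open>z\<^sup>m\<^sup>' q\<close>, inserted in the second-order condition for a tangent
  vector \<open>B\<close>, say that the moment functional of \<open>B\<close> annihilates \<open>z\<^sup>m\<^sup>+\<^sup>m\<^sup>' q\<^sup>2\<close>. All admissible exponents
  \<open>p\<close> are such sums.
\<close>
lemma tangent_annihilates_square:
  fixes A B :: "complex^'n::{finite,linorder}^'n::{finite,linorder}"
  assumes A: "A \<in> stratum k 0" and k: "k < CARD('n)"
    and B: "B \<in> tangent_space (rank_le_matrices k) A" "B \<in> hankel_matrices"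
    and p: "p + 2 * k < 2 * CARD('n) - 1"
  defines "q \<equiv> recurrence_poly k (symbol A)"
  shows "(\<Sum>i\<le>k. \<Sum>j\<le>k. q i * q j * symbol B (i + j + p)) = 0"
proof -
  let ?N = "CARD('n)"
  define h where "h = symbol A"
  have nd: "nondegenerate k h" using A by (simp add: stratum_def h_def)
  have A_cont: "A = hankel (continuation k h)"
    unfolding h_def using A by (rule generic_stratum_eq_hankel_continuation)
  have q_annihilates: "(\<Sum>i\<le>k. q i * continuation k h (i + p)) = 0" for p
    using recurrence_poly_annihilates_continuation[of k h p, where 'n = 'n] k nd
    by (simp add: q_def h_def)
  \<comment> \<open>The coefficient vector of \<open>z\<^sup>m q\<close>.\<close>
  define w where "w m = (\<chi> i::'n. if m \<le> index_pos i then q (index_pos i - m) else 0)" for m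
  have sum_w: "(\<Sum>j<?N. w m $ index_at j * g j) = (\<Sum>i\<le>k. q i * g (i + m))" if "m + k < ?N" for m g
  proof -
    have "(\<Sum>j<?N. w m $ index_at j * g j) = (\<Sum>j<?N. (if m \<le> j then q (j - m) else 0) * g j)"
      by (intro sum.cong) (auto simp: w_def)
    also have "\<dots> = (\<Sum>i\<le>k. q i * g (i + m))"
      using that by (intro sum_shifted_support) (auto simp: q_def recurrence_poly_def)
    finally show ?thesis .
  qed
  have w_left: "w m v* A = 0" if "m + k < ?N" for m
  proof (subst vec_eq_iff, rule allI)
    fix i
    have "(w m v* A) $ i = (\<Sum>j<?N. w m $ index_at j * continuation k h (index_pos i + j))"
      by (subst A_cont, subst vector_mult_hankel_nth) (simp add: mult.commute)
    also have "\<dots> = 0"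
      using q_annihilates[of "m + index_pos i"] by (simp add: sum_w[OF that] ac_simps)
    finally show "(w m v* A) $ i = 0 $ i" by simp
  qed
  have hankel_mult: "hankel g *v x = x v* (hankel g :: complex^'n::{finite,linorder}^'n::{finite,linorder})"
    for g x
    by (simp add: vec_eq_iff matrix_vector_mult_def vector_matrix_mult_def ac_simps)
  \<comment> \<open>The first \<open>k\<close> rows of \<open>A\<close> are independent because the leading block is regular.\<close>
  define J where "J = (index_at :: nat \<Rightarrow> 'n) ` {..<k}"
  have "card J = k"
    unfolding J_def using k
    by (subst card_image) (auto intro!: inj_onI dest: arg_cong[of _ _ "index_pos"])
  have J_inj: "x = 0" if x: "x v* A = 0" "\<And>j. j \<notin> J \<Longrightarrow> x $ j = 0" for x
  proof -
    have out: "x $ index_at j = 0" if "k \<le> j" "j < ?N" for j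
    proof (rule x(2), rule notI)
      assume "(index_at j :: 'n) \<in> J"
      then obtain i where "i < k" "(index_at j :: 'n) = index_at i" by (auto simp: J_def)
      then show False using that k by (metis index_pos_index_at not_less order.strict_trans)
    qed
    have "(\<Sum>j<k. h (i + j) * x $ index_at j) = 0" if "i < k" for i
    proof -
      have "(\<Sum>j<k. h (i + j) * x $ index_at j) =
          (\<Sum>j<k. continuation k h (i + j) * x $ index_at j)"
        using that by (intro sum.cong) (auto simp: continuation_initial)
      also have "\<dots> = (\<Sum>j<?N. continuation k h (i + j) * x $ index_at j)"
        using k out by (intro sum.mono_neutral_left) auto
      also have "\<dots> = (x v* A) $ index_at i"
        using that k by (subst A_cont, subst vector_mult_hankel_nth) simp
      finally show ?thesis using x(1) by simp
    qed
    with nd have low: "x $ index_at j = 0" if "j < k" for j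
      using that unfolding nondegenerate_def by (elim allE[of _ "\<lambda>j. x $ index_at j"]) auto
    have "x $ i = 0" for i
      using low[of "index_pos i"] out[of "index_pos i"] index_pos_less_CARD[of i]
      by (cases "index_pos i < k") auto
    then show ?thesis by (simp add: vec_eq_iff)
  qed
  \<comment> \<open>Each summand must stay below \<open>N - k\<close>, so that the shifted polynomial has degree below \<open>N\<close>.\<close>
  define m where "m = min p (?N - 1 - k)"
  define m' where "m' = p - m"
  have m: "m + k < ?N" "m' + k < ?N" "m + m' = p"
    using p k by (auto simp: m_def m'_def)
  have B_hankel: "B = hankel (symbol B)"
    using B(2) by (rule hankel_symbol[symmetric])
  have "A *v w m' = 0"
    using w_left[OF m(2)] unfolding A_cont hankel_mult .
  then have "0 = (\<Sum>i\<in>UNIV. w m $ i * (B *v w m') $ i)"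
    using tangent_rank_le_matrices_kernels[OF _ \<open>card J = k\<close> J_inj w_left[OF m(1)]] B(1) by simp
  also have "\<dots> = (\<Sum>i\<in>(UNIV :: 'n set). (\<lambda>i. w m $ index_at i *
      (\<Sum>j\<le>k. q j * symbol B (i + j + m'))) (index_pos i))"
  proof (intro sum.cong refl)
    fix i :: 'n
    have "(B *v w m') $ i = (\<Sum>j<?N. w m' $ index_at j * symbol B (index_pos i + j))"
      by (subst B_hankel, subst hankel_mult, subst vector_mult_hankel_nth) (simp add: mult.commute)
    then show "w m $ i * (B *v w m') $ i = (\<lambda>i. w m $ index_at i *
        (\<Sum>j\<le>k. q j * symbol B (i + j + m'))) (index_pos i)"
      by (simp add: sum_w[OF m(2)] ac_simps)
  qed
  also have "\<dots> = (\<Sum>i<?N. w m $ index_at i * (\<Sum>j\<le>k. q j * symbol B (i + j + m')))"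
    by (rule sum_index_pos)
  also have "\<dots> = (\<Sum>i\<le>k. q i * (\<Sum>j\<le>k. q j * symbol B (i + m + j + m')))"
    by (rule sum_w[OF m(1)])
  also have "\<dots> = (\<Sum>i\<le>k. \<Sum>j\<le>k. q i * q j * symbol B (i + j + p))"
    by (simp add: sum_distrib_left m(3)[symmetric] ac_simps)
  finally show ?thesis by simp
qed

text \<open>
  A common tangent vector \<open>B\<close> of the Hankel matrices and of the matrices of rank at most \<open>k\<close> has a
  moment functional that vanishes on the multiples of \<open>q\<^sup>2\<close>, so it is determined by its first \<open>2 * k\<close>
  terms. The points of the generic stratum are also parametrized by these terms, so some curve in
  it has a velocity with the same \<open>2 * k\<close> terms as \<open>B\<close>. As this velocity is again a common tangent
  vector, it equals \<open>B\<close>.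
\<close>
lemma generic_stratum_tangent_space:
  fixes A :: "complex^'n::{finite,linorder}^'n::{finite,linorder}"
  assumes A: "A \<in> stratum k 0" and k: "k < CARD('n)"
  shows "tangent_space (rank_le_matrices k) A \<inter> tangent_space hankel_matrices A =
    tangent_space (rank_le_matrices k \<inter> hankel_matrices) A" (is "?R \<inter> ?H = ?RH")
proof
  let ?N = "CARD('n)"
  define h where "h = symbol A"
  have nd: "nondegenerate k h" using A by (simp add: stratum_def h_def)
  have A_cont: "A = hankel (continuation k h)"
    unfolding h_def using A by (rule generic_stratum_eq_hankel_continuation)
  define q where "q = recurrence_poly k h"
  have square: "(\<Sum>i\<le>k. \<Sum>j\<le>k. q i * q j * symbol B (i + j + p)) = 0"
    if B: "B \<in> ?R \<inter> ?H" and p: "p + 2 * k < 2 * ?N - 1" for B p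
    unfolding q_def h_def
    using B tangent_space_hankel_matrices[of A] by (intro tangent_annihilates_square A k p) auto
  show RH_le: "?RH \<subseteq> ?R \<inter> ?H"
    using tangent_space_mono[of "rank_le_matrices k \<inter> hankel_matrices"] by auto
  show "?R \<inter> ?H \<subseteq> ?RH"
  proof
    fix B assume B: "B \<in> ?R \<inter> ?H"
    let ?U = "{M :: complex^'n::{finite,linorder}^'n::{finite,linorder}. nondegenerate k (symbol M)}"
    \<comment> \<open>The curve moves the first \<open>2 * k\<close> terms along \<open>B\<close> and continues them by their recurrence.\<close>
    define \<Gamma> :: "complex^'n::{finite,linorder}^'n::{finite,linorder} \<Rightarrow> complex^'n::{finite,linorder}^'n::{finite,linorder}"
      where "\<Gamma> M = hankel (continuation k (symbol M))" for M
    define \<gamma> where "\<gamma> t = \<Gamma> (A + t *\<^sub>R B)" for t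
    have C1_\<Gamma>: "C1_on \<Gamma> ?U"
      unfolding \<Gamma>_def using k by (intro C1_on_matrix, unfold hankel_nth) (intro C1_on_continuation, simp)
    have line: "continuous_on UNIV (\<lambda>t. A + t *\<^sub>R B)" by (intro continuous_intros)
    have "open ((\<lambda>t. A + t *\<^sub>R B) -` ?U)"
      using k open_nondegenerate[of k, where 'n = 'n] line by (intro open_vimage) auto
    moreover have "0 \<in> (\<lambda>t. A + t *\<^sub>R B) -` ?U" using nd by (simp add: h_def)
    ultimately obtain e where e: "0 < e" "ball 0 e \<subseteq> (\<lambda>t. A + t *\<^sub>R B) -` ?U"
      using open_contains_ball by blast
    have ball: "ball 0 e = {-e<..<e}" by (auto simp: dist_real_def)
    have "C1_on (\<lambda>t. A + t *\<^sub>R B) {-e<..<e}"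
      by (intro C1_on_add C1_on_const C1_on_bounded_linear bounded_linear_scaleR_left)
    then have C1_\<gamma>: "C1_on \<gamma> {-e<..<e}"
      unfolding \<gamma>_def using e(2) ball by (intro C1_on_compose[OF C1_\<Gamma>]) auto
    then obtain B' where B': "(\<gamma> has_vector_derivative B') (at 0)"
    proof -
      obtain \<gamma>' where "\<forall>t\<in>{-e<..<e}. (\<gamma> has_derivative blinfun_apply (\<gamma>' t)) (at t)"
        using C1_\<gamma> unfolding C1_on_def by blast
      with e(1) have "(\<gamma> has_derivative blinfun_apply (\<gamma>' 0)) (at 0)" by simp
      then have "(\<gamma> has_vector_derivative blinfun_apply (\<gamma>' 0) 1) (at 0)"
        unfolding has_vector_derivative_def
        by (simp add: blinfun.scaleR_right[symmetric])
      then show ?thesis using that by blast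
    qed
    have "\<gamma> t \<in> rank_le_matrices k \<inter> hankel_matrices" if "t \<in> {-e<..<e}" for t
      using e(2) that k ball
      by (auto simp: \<gamma>_def \<Gamma>_def rank_le_matrices_def hankel_in_hankel_matrices
        intro!: rank_hankel_continuation)
    moreover have "\<gamma> 0 = hankel (continuation k h)" by (simp add: \<gamma>_def \<Gamma>_def h_def)
    then have "\<gamma> 0 = A" using A_cont by (rule trans[OF _ sym])
    ultimately have B'_RH: "B' \<in> ?RH"
      unfolding tangent_space_def using e(1) C1_\<gamma> B' by blast
    have initial: "symbol B' m = symbol B m" if "m < 2 * k" for m
    proof -
      have "((\<lambda>t. symbol (\<gamma> t) m) has_vector_derivative symbol B' m) (at 0)"
        by (intro bounded_linear.has_vector_derivative[OF bounded_linear_symbol] B')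
      moreover have "(\<lambda>t. symbol (\<gamma> t) m) = (\<lambda>t. symbol A m + t *\<^sub>R symbol B m)"
      proof
        fix t
        have "symbol (\<gamma> t) m = symbol (A + t *\<^sub>R B) m"
          using that k by (simp add: \<gamma>_def \<Gamma>_def symbol_hankel continuation_initial)
        then show "symbol (\<gamma> t) m = symbol A m + t *\<^sub>R symbol B m" by (simp add: symbol_def)
      qed
      moreover have "((\<lambda>t. symbol A m + t *\<^sub>R symbol B m) has_vector_derivative symbol B m) (at 0)"
        by (auto intro!: derivative_eq_intros)
      ultimately show ?thesis
        using vector_derivative_unique_at[of _ "symbol B' m" 0 "symbol B m"] by simp
    qed
    \<comment> \<open>Both \<open>B\<close> and \<open>B'\<close> are common tangent vectors, and they have the same first \<open>2 * k\<close> terms.\<close>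
    have "symbol B m = symbol B' m" if "m < 2 * ?N - 1" for m
    proof -
      have "symbol B m - symbol B' m = 0"
      proof (rule zero_if_annihilated_by_square[where q = q and k = k and n = "2 * ?N - 1"])
        fix p assume p: "p + 2 * k < 2 * ?N - 1"
        show "(\<Sum>i\<le>k. \<Sum>j\<le>k. q i * q j * (symbol B (i + j + p) - symbol B' (i + j + p))) = 0"
          using square[OF B p] square[OF subsetD[OF RH_le B'_RH] p]
          by (simp add: right_diff_distrib sum_subtractf)
      qed (use initial that in \<open>auto simp: q_def recurrence_poly_def\<close>)
      then show ?thesis by simp
    qed
    then have "hankel (symbol B) = (hankel (symbol B') :: complex^'n::{finite,linorder}^'n::{finite,linorder})"
      by (rule hankel_cong)
    moreover have "B \<in> hankel_matrices" "B' \<in> hankel_matrices"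
      using B subsetD[OF RH_le B'_RH] tangent_space_hankel_matrices[of A] by blast+
    ultimately have "B = B'" using hankel_symbol[of B] hankel_symbol[of B'] by simp
    with B'_RH show "B \<in> ?RH" by simp
  qed
qed

section \<open>Thinness of the set of tangential points\<close>

theorem theorem8:
  fixes k :: nat
  assumes "1 \<le> k" and "k < CARD('n::{finite,linorder})"
  shows "thin (4 * k) {A :: complex^'n::{finite,linorder}^'n::{finite,linorder}. tangential k A}"
proof -
  let ?I = "{(r, s). r + s \<le> k \<and> (r, s) \<noteq> (k, 0)}"
  let ?M = "(\<lambda>(r, s). stratum r s :: (complex^'n::{finite,linorder}^'n::{finite,linorder}) set) ` ?I"
  have "?I \<subseteq> {..k} \<times> {..k}" by auto
  then have "finite ?M" by (intro finite_imageI) (rule finite_subset, auto)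
  moreover have "\<exists>m<4 * k. manifold m M" if "M \<in> ?M" for M
  proof -
    obtain r s where M: "M = stratum r s" "r + s \<le> k" "(r, s) \<noteq> (k, 0)" using \<open>M \<in> ?M\<close> by auto
    \<comment> \<open>\<open>2 * r + s = (r + s) + r\<close> reaches \<open>2 * k\<close> only if \<open>r = k\<close> and \<open>s = 0\<close>.\<close>
    then have "2 * (2 * r + s) < 4 * k" by auto
    moreover obtain d where "d \<le> 2 * (2 * r + s)" "manifold d M"
      using manifold_stratum[of r s, where 'n = 'n] M assms(2) by auto
    ultimately show ?thesis by (intro exI[of _ d]) simp
  qed
  moreover have "{A. tangential k A} \<subseteq> \<Union> ?M"
  proof
    fix A :: "complex^'n::{finite,linorder}^'n::{finite,linorder}"
    assume "A \<in> {A. tangential k A}"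
    then have "A \<in> hankel_rank_le k" and "A \<notin> stratum k 0"
      using generic_stratum_tangent_space[of A k] assms(2)
      by (auto simp: tangential_def regular_point_def)
    then show "A \<in> \<Union> ?M"
      using hankel_rank_le_covered[of A k] assms(2) by fastforce
  qed
  ultimately show ?thesis unfolding thin_def by blast
qed

end
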